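(* For any finite Coxeter system $(W,S)$, the assignment $[\gamma]\mapsto\mathbf s_\gamma$, $[-\gamma]\mapsto-\mathbf s_\gamma$ ($\gamma\in\Delta_+$) defines a representation of the bracket algebra $BE(W,S)$ on the group ring $\mathbb R\langle W\rangle$, where $\mathbf s_\gamma$ is the linear operator given on basis elements $w\in W$ by $\mathbf s_\gamma.w=ws_\gamma$ if $l(ws_\gamma)=l(w)+1$, and $\mathbf s_\gamma.w=0$ otherwise.
   Context: Let $(W,S)$ be a finite Coxeter system with length function $l$, $V$ the real vector space with basis $\{\alpha_s\}_{s\in S}$ and form $(\alpha_s,\alpha_{s'})=-\cos(\pi/m(s,s'))$, $W$ acting by $s(\lambda)=\lambda-2(\alpha_s,\lambda)\alpha_s$, $\Delta=\{w(\alpha_s)\}$ the roots (normalized so that $2(\gamma,\gamma')/(\gamma,\gamma)\in\mathbb Z$ if $(W,S)$ is crystallographic), $\Delta_+$ the positive roots, $s_\gamma$ the reflection in $\gamma$. $BE(W,S)$: associative $\mathbb R$-algebra with generators $[\gamma]$, $\gamma\in\Delta$, relations (i) $[-\gamma]=-[\gamma]$; (ii) $[\gamma]^2=0$; (iii) whenever $\gamma_0,\dots,\gamma_{m-1}\in\Delta_+$ ($m\ge2$) are such that $\{\pm\gamma_i\}$ is a root system of type $I_2(m)$ and $\mathbb R_{\ge0}\gamma_i+\mathbb R_{\ge0}\gamma_{i+1}$ meets $\Delta_+$ exactly in $\{\gamma_i,\gamma_{i+1}\}$ ($i=0,\dots,m-2$), then with $\gamma_{j+m}=-\gamma_j$: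 $\sum_{i=0}^{m-1}[\gamma_i][\gamma_{i+k}]=0$ for each integer $1\le k\le m/2$; (iv) for such $\gamma_i$ with $m\ge4$, $k=\lfloor m/2\rfloor-1$: $[\gamma_k][\gamma_0]\cdots[\gamma_{2k}]+[\gamma_0]\cdots[\gamma_{2k}][\gamma_k]+[\gamma_k][\gamma_{2k}]\cdots[\gamma_0]+[\gamma_{2k}]\cdots[\gamma_0][\gamma_k]=0$. *)

theory Defs
  imports "HOL-Analysis.Finite_Function_Topology" "HOL-Algebra.Module" "HOL-Algebra.QuotRing"
    "HOL-Algebra.Generated_Groups" "HOL-Algebra.Multiplicative_Group"
begin

section \<open>Finite Coxeter systems\<close>

definition word_prod :: "('a, 'x) monoid_scheme \<Rightarrow> 'a list \<Rightarrow> 'a" where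
  "word_prod W xs = foldr (\<otimes>\<^bsub>W\<^esub>) xs \<one>\<^bsub>W\<^esub>"

definition coxeter_order :: "('a, 'x) monoid_scheme \<Rightarrow> 'a \<Rightarrow> 'a \<Rightarrow> nat" where
  "coxeter_order W s t = group.ord W (s \<otimes>\<^bsub>W\<^esub> t)"

text \<open>The congruence on words in \<open>S\<close> generated by \<open>(s t) ^ m(s,t) = 1\<close>. For \<open>s = t\<close> this relation
  is \<open>s s = 1\<close>, so the monoid of words modulo the congruence is the group presented by
  these relations. (\<open>group.ord\<close> is 0 for elements of infinite order, and the relation is then void.)\<close>

inductive coxeter_cong :: "('a, 'x) monoid_scheme \<Rightarrow> 'a set \<Rightarrow> 'a list \<Rightarrow> 'a list \<Rightarrow> bool"
  for W S where
  rel: "\<lbrakk>s \<in> S; t \<in> S; xs \<in> lists S; ys \<in> lists S\<rbrakk> \<Longrightarrow>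
    coxeter_cong W S (xs @ concat (replicate (coxeter_order W s t) [s, t]) @ ys) (xs @ ys)"
| refl: "xs \<in> lists S \<Longrightarrow> coxeter_cong W S xs xs"
| sym: "coxeter_cong W S xs ys \<Longrightarrow> coxeter_cong W S ys xs"
| trans: "\<lbrakk>coxeter_cong W S xs ys; coxeter_cong W S ys zs\<rbrakk> \<Longrightarrow> coxeter_cong W S xs zs"

locale finite_coxeter_system = group W for W :: "('a, 'x) monoid_scheme" (structure) +
  fixes S :: "'a set"
  assumes finite_carrier: "finite (carrier W)"
    and S_subset: "S \<subseteq> carrier W"
    and S_generates: "generate W S = carrier W"
    and S_involutions: "\<And>s. s \<in> S \<Longrightarrow> ord s = 2"
    and S_presentation: "\<And>xs ys. \<lbrakk>xs \<in> lists S; ys \<in> lists S; word_prod W xs = word_prod W ys\<rbrakk>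
      \<Longrightarrow> coxeter_cong W S xs ys"

definition coxeter_length :: "('a, 'x) monoid_scheme \<Rightarrow> 'a set \<Rightarrow> 'a \<Rightarrow> nat" where
  "coxeter_length W S w = (LEAST n. \<exists>xs\<in>lists S. length xs = n \<and> word_prod W xs = w)"

definition crystallographic :: "('a, 'x) monoid_scheme \<Rightarrow> 'a set \<Rightarrow> bool" where
  "crystallographic W S \<longleftrightarrow> (\<forall>s\<in>S. \<forall>t\<in>S. s \<noteq> t \<longrightarrow> coxeter_order W s t \<in> {2, 3, 4, 6})"


section \<open>The geometric representation and the roots\<close>

definition coxeter_space :: "'a set \<Rightarrow> ('a \<Rightarrow>\<^sub>0 real) set" where
  "coxeter_space S = {v. Poly_Mapping.keys v \<subseteq> S}"

definition basis_root :: "'a \<Rightarrow> ('a \<Rightarrow>\<^sub>0 real)" where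
  "basis_root s = Poly_Mapping.single s 1"

text \<open>The diagonal entries are \<open>- cos pi = 1\<close>, because \<open>coxeter_order W s s = 1\<close>.\<close>

definition coxeter_form ::
  "('a, 'x) monoid_scheme \<Rightarrow> 'a set \<Rightarrow> ('a \<Rightarrow>\<^sub>0 real) \<Rightarrow> ('a \<Rightarrow>\<^sub>0 real) \<Rightarrow> real" where
  "coxeter_form W S u v = (\<Sum>s\<in>S. \<Sum>t\<in>S.
     Poly_Mapping.lookup u s * Poly_Mapping.lookup v t * (- cos (pi / real (coxeter_order W s t))))"

definition simple_reflection ::
  "('a, 'x) monoid_scheme \<Rightarrow> 'a set \<Rightarrow> 'a \<Rightarrow> ('a \<Rightarrow>\<^sub>0 real) \<Rightarrow> ('a \<Rightarrow>\<^sub>0 real)" where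
  "simple_reflection W S s v = v - (2 * coxeter_form W S (basis_root s) v) *\<^sub>R basis_root s"

text \<open>\<open>w\<close> acts as the product of the simple reflections along any word for \<open>w\<close>; as the simple
  reflections satisfy the Coxeter relations, the result does not depend on the word.\<close>

definition coxeter_action ::
  "('a, 'x) monoid_scheme \<Rightarrow> 'a set \<Rightarrow> 'a \<Rightarrow> ('a \<Rightarrow>\<^sub>0 real) \<Rightarrow> ('a \<Rightarrow>\<^sub>0 real)" where
  "coxeter_action W S w v =
     foldr (simple_reflection W S) (SOME xs. xs \<in> lists S \<and> word_prod W xs = w) v"

text \<open>The roots are normalized by a positive length factor \<open>c s\<close> for each simple root, so that the
  simple roots are \<open>c s \<alpha>\<^sub>s\<close>.\<close>

definition roots ::
  "('a, 'x) monoid_scheme \<Rightarrow> 'a set \<Rightarrow> ('a \<Rightarrow> real) \<Rightarrow> ('a \<Rightarrow>\<^sub>0 real) set" where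
  "roots W S c = {coxeter_action W S w (c s *\<^sub>R basis_root s) | w s. w \<in> carrier W \<and> s \<in> S}"

definition pos_roots ::
  "('a, 'x) monoid_scheme \<Rightarrow> 'a set \<Rightarrow> ('a \<Rightarrow> real) \<Rightarrow> ('a \<Rightarrow>\<^sub>0 real) set" where
  "pos_roots W S c = {v \<in> roots W S c. \<forall>s\<in>S. 0 \<le> Poly_Mapping.lookup v s}"

text \<open>The factor is constant on conjugate generators, that is on \<open>W\<close>-orbits of simple roots, so
  that a root \<open>v\<close> has only the multiples \<open>v\<close> and \<open>-v\<close> among the roots. If \<open>(W, S)\<close> is not
  crystallographic, \<open>c = (\<lambda>_. 1)\<close> is the choice of unit roots; other invariant
  factors are allowed as well.\<close>

definition root_normalization :: "('a, 'x) monoid_scheme \<Rightarrow> 'a set \<Rightarrow> ('a \<Rightarrow> real) \<Rightarrow> bool" where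
  "root_normalization W S c \<longleftrightarrow>
     (\<forall>s\<in>S. 0 < c s) \<and>
     (\<forall>s\<in>S. \<forall>t\<in>S. (\<exists>w\<in>carrier W. w \<otimes>\<^bsub>W\<^esub> s \<otimes>\<^bsub>W\<^esub> inv\<^bsub>W\<^esub> w = t) \<longrightarrow> c s = c t) \<and>
     (crystallographic W S \<longrightarrow> (\<forall>u\<in>roots W S c. \<forall>v\<in>roots W S c.
        2 * coxeter_form W S u v / coxeter_form W S u u \<in> \<int>))"

definition form_reflection ::
  "('v \<Rightarrow> 'v \<Rightarrow> real) \<Rightarrow> 'v \<Rightarrow> 'v \<Rightarrow> 'v::real_vector" where
  "form_reflection B u v = v - (2 * B u v / B u u) *\<^sub>R u"

definition root_reflection ::
  "('a, 'x) monoid_scheme \<Rightarrow> 'a set \<Rightarrow> ('a \<Rightarrow>\<^sub>0 real) \<Rightarrow> 'a" where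
  "root_reflection W S u = (THE r. r \<in> carrier W \<and>
     (\<forall>v\<in>coxeter_space S. coxeter_action W S r v = form_reflection (coxeter_form W S) u v))"

text \<open>A (reduced) root system with a simple system \<open>{u, v}\<close> whose Coxeter graph is \<open>I\<^sub>2(m)\<close>; the two
  simple roots may have different lengths.\<close>

definition root_system_I2 ::
  "('v \<Rightarrow> 'v \<Rightarrow> real) \<Rightarrow> nat \<Rightarrow> 'v::real_vector set \<Rightarrow> bool" where
  "root_system_I2 B m R \<longleftrightarrow>
     finite R \<and> 0 \<notin> R \<and>
     (\<forall>u\<in>R. form_reflection B u ` R = R) \<and>
     (\<forall>u\<in>R. R \<inter> range (\<lambda>r. r *\<^sub>R u) = {u, - u}) \<and>
     (\<exists>u\<in>R. \<exists>v\<in>R. u \<noteq> v \<and> independent {u, v} \<and>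
        R \<subseteq> {a *\<^sub>R u + b *\<^sub>R v | a b. (0 \<le> a \<and> 0 \<le> b) \<or> (a \<le> 0 \<and> b \<le> 0)} \<and>
        B u v = - cos (pi / real m) * sqrt (B u u) * sqrt (B v v))"


section \<open>The bracket algebra\<close>

text \<open>Words form a monoid under concatenation, so \<open>'v list \<Rightarrow>\<^sub>0 real\<close> with the convolution product
  of \<open>Poly_Mapping\<close> is the free associative algebra on \<open>'v\<close>.\<close>

instantiation list :: (type) monoid_add
begin

definition zero_list :: "'a list" where "zero_list = []"

definition plus_list :: "'a list \<Rightarrow> 'a list \<Rightarrow> 'a list" where "plus_list xs ys = xs @ ys"

instance
  by standard (simp_all add: zero_list_def plus_list_def)

end

definition free_algebra :: "'v set \<Rightarrow> (real, 'v list \<Rightarrow>\<^sub>0 real) module" where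
  "free_algebra D =
     \<lparr>carrier = {f. Poly_Mapping.keys f \<subseteq> lists D}, monoid.mult = (*), one = 1,
      ring.zero = 0, ring.add = (+),
      smult = (*\<^sub>R)\<rparr>"

definition free_gen :: "'v \<Rightarrow> ('v list \<Rightarrow>\<^sub>0 real)" where
  "free_gen v = Poly_Mapping.single [v] 1"

text \<open>The sequences \<open>\<gamma>\<^sub>0, \<dots>, \<gamma>\<^bsub>m-1\<^esub>\<close> of positive roots occurring in the relations, continued by
  \<open>\<gamma>\<^bsub>j+m\<^esub> = -\<gamma>\<^sub>j\<close>.\<close>

definition dihedral_sequence ::
  "('a, 'x) monoid_scheme \<Rightarrow> 'a set \<Rightarrow> ('a \<Rightarrow> real) \<Rightarrow> nat \<Rightarrow> (nat \<Rightarrow> 'a \<Rightarrow>\<^sub>0 real) \<Rightarrow> bool" where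
  "dihedral_sequence W S c m g \<longleftrightarrow>
     2 \<le> m \<and>
     (\<forall>i<m. g i \<in> pos_roots W S c) \<and>
     (\<forall>j. g (j + m) = - g j) \<and>
     root_system_I2 (coxeter_form W S) m (g ` {..<m} \<union> (\<lambda>i. - g i) ` {..<m}) \<and>
     (\<forall>i. i + 1 < m \<longrightarrow>
        {a *\<^sub>R g i + b *\<^sub>R g (i + 1) | a b. 0 \<le> a \<and> 0 \<le> b} \<inter> pos_roots W S c = {g i, g (i + 1)})"

definition bracket_relations ::
  "('a, 'x) monoid_scheme \<Rightarrow> 'a set \<Rightarrow> ('a \<Rightarrow> real) \<Rightarrow> (('a \<Rightarrow>\<^sub>0 real) list \<Rightarrow>\<^sub>0 real) set" where
  "bracket_relations W S c =
     {free_gen (- v) + free_gen v | v. v \<in> roots W S c} \<union>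
     {free_gen v * free_gen v | v. v \<in> roots W S c} \<union>
     {\<Sum>i<m. free_gen (g i) * free_gen (g (i + k)) | m g k.
        dihedral_sequence W S c m g \<and> 1 \<le> k \<and> 2 * k \<le> m} \<union>
     {let k = m div 2 - 1; up = map (\<lambda>i. free_gen (g i)) [0..<2 * k + 1]; x = free_gen (g k) in
        x * prod_list up + prod_list up * x + x * prod_list (rev up) + prod_list (rev up) * x | m g.
        dihedral_sequence W S c m g \<and> 4 \<le> m}"

definition bracket_ideal ::
  "('a, 'x) monoid_scheme \<Rightarrow> 'a set \<Rightarrow> ('a \<Rightarrow> real) \<Rightarrow> (('a \<Rightarrow>\<^sub>0 real) list \<Rightarrow>\<^sub>0 real) set" where
  "bracket_ideal W S c = genideal (free_algebra (roots W S c)) (bracket_relations W S c)"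

definition bracket_class ::
  "('a, 'x) monoid_scheme \<Rightarrow> 'a set \<Rightarrow> ('a \<Rightarrow> real) \<Rightarrow> (('a \<Rightarrow>\<^sub>0 real) list \<Rightarrow>\<^sub>0 real)
     \<Rightarrow> (('a \<Rightarrow>\<^sub>0 real) list \<Rightarrow>\<^sub>0 real) set" where
  "bracket_class W S c f = bracket_ideal W S c +>\<^bsub>free_algebra (roots W S c)\<^esub> f"

text \<open>\<open>FactRing\<close> is only a ring, so the scalar multiplication is added, as multiplication by the
  class of \<open>r 1\<close>.\<close>

definition bracket_algebra ::
  "('a, 'x) monoid_scheme \<Rightarrow> 'a set \<Rightarrow> ('a \<Rightarrow> real)
     \<Rightarrow> (real, (('a \<Rightarrow>\<^sub>0 real) list \<Rightarrow>\<^sub>0 real) set) module" where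
  "bracket_algebra W S c =
     (let Q = free_algebra (roots W S c) Quot bracket_ideal W S c in
      \<lparr>carrier = carrier Q, monoid.mult = monoid.mult Q, one = one Q,
       ring.zero = ring.zero Q, ring.add = ring.add Q,
       smult = (\<lambda>r X. bracket_class W S c (r *\<^sub>R 1) \<otimes>\<^bsub>Q\<^esub> X)\<rparr>)"

definition bracket_gen ::
  "('a, 'x) monoid_scheme \<Rightarrow> 'a set \<Rightarrow> ('a \<Rightarrow> real) \<Rightarrow> ('a \<Rightarrow>\<^sub>0 real)
     \<Rightarrow> (('a \<Rightarrow>\<^sub>0 real) list \<Rightarrow>\<^sub>0 real) set" where
  "bracket_gen W S c v = bracket_class W S c (free_gen v)"


section \<open>Representations\<close>

text \<open>Operators are functions on the subspace \<open>U\<close>, extended by \<open>undefined\<close> outside \<open>U\<close>.\<close>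

definition End_algebra :: "'u::real_vector set \<Rightarrow> (real, 'u \<Rightarrow> 'u) module" where
  "End_algebra U =
     \<lparr>carrier = {T \<in> U \<rightarrow>\<^sub>E U. (\<forall>x\<in>U. \<forall>y\<in>U. T (x + y) = T x + T y) \<and>
                              (\<forall>r. \<forall>x\<in>U. T (r *\<^sub>R x) = r *\<^sub>R T x)},
      monoid.mult = compose U, one = (\<lambda>x\<in>U. x),
      ring.zero = (\<lambda>x\<in>U. 0), ring.add = (\<lambda>T T'. \<lambda>x\<in>U. T x + T' x),
      smult = (\<lambda>r T. \<lambda>x\<in>U. r *\<^sub>R T x)\<rparr>"

definition algebra_hom ::
  "(real, 'b, 'y) module_scheme \<Rightarrow> (real, 'c, 'z) module_scheme \<Rightarrow> ('b \<Rightarrow> 'c) set" where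
  "algebra_hom A B =
     {h \<in> ring_hom A B. \<forall>r. \<forall>x\<in>carrier A. h (r \<odot>\<^bsub>A\<^esub> x) = r \<odot>\<^bsub>B\<^esub> h x}"

definition representations ::
  "(real, 'b, 'y) module_scheme \<Rightarrow> 'u::real_vector set \<Rightarrow> ('b \<Rightarrow> 'u \<Rightarrow> 'u) set" where
  "representations A U = algebra_hom A (End_algebra U)"

definition group_ring :: "('a, 'x) monoid_scheme \<Rightarrow> ('a \<Rightarrow>\<^sub>0 real) set" where
  "group_ring W = {f. Poly_Mapping.keys f \<subseteq> carrier W}"

definition bruhat_operator ::
  "('a, 'x) monoid_scheme \<Rightarrow> 'a set \<Rightarrow> ('a \<Rightarrow>\<^sub>0 real) \<Rightarrow> ('a \<Rightarrow>\<^sub>0 real) \<Rightarrow> ('a \<Rightarrow>\<^sub>0 real)" where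
  "bruhat_operator W S v = (\<lambda>f\<in>group_ring W. \<Sum>w\<in>carrier W. Poly_Mapping.lookup f w *\<^sub>R
     (let w' = w \<otimes>\<^bsub>W\<^esub> root_reflection W S v in
      if coxeter_length W S w' = coxeter_length W S w + 1 then Poly_Mapping.single w' 1 else 0))"

end

theory Submission
  imports Defs
begin

text \<open>For a positive root \<open>\<gamma>\<close> one has \<open>l(w s\<^sub>\<gamma>) > l(w)\<close> iff \<open>w(\<gamma>)\<close> is positive. The roots
  \<open>\<gamma>\<^sub>0, \<dots>, \<gamma>\<^bsub>m-1\<^esub>\<close> of a dihedral sequence point in consecutive multiples of the angle \<open>\<pi>/m\<close>, so that
  \<open>t\<^sub>j t\<^sub>i\<close> depends only on \<open>j - i\<close>, where \<open>t\<^sub>i\<close> is the reflection in \<open>\<gamma>\<^sub>i\<close>. Hence all terms of relation (iii)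
  send \<open>w\<close> to multiples of one element \<open>w r\<close>; if \<open>l(w r) = l(w) + 2\<close>, a term is nonzero iff both of its
  steps are ascents, and the ascents with sign \<open>+\<close> are as many as those with sign \<open>-\<close>. In relation (iv)
  no signs occur, but the reflections along each word multiply to 1, while a nonzero term would raise
  the length; so every term vanishes.\<close>

section \<open>Reflections in a plane\<close>

text \<open>Neither the signs nor the angles are given. Positivity of roots is derived from the
  presentation of \<open>W\<close>, and the angles of a dihedral sequence must be recovered from
  conditions on neighbouring roots only. Root lengths may differ, so only directions are compared;
  reflections do not see lengths. The signs in relation (iii) come from the indices
  \<open>i + k \<ge> m\<close>, which stand for negative roots. The second step of a term is taken
  at \<open>w t_(i+k)\<close>; since the reflection \<open>t_(i+k)\<close> exchanges the directions
  \<open>i\<close> and \<open>i + 2k\<close> up to sign, it becomes a condition on \<open>w\<close>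
  and the index \<open>i + 2k\<close>. For fixed \<open>w\<close>, the indices \<open>j\<close> with
  positive \<open>w(\<gamma>_j)\<close> form a half-turn among \<open>2m\<close> directions, so the
  sum is a count that depends only on the position of this half-turn. The relations hold in a
  quotient of the free algebra. Words are therefore evaluated in the free algebra, and the elements
  that evaluate to zero on the group ring form an ideal containing the relations.\<close>

locale symmetric_bilinear =
  fixes B :: "'v::real_vector \<Rightarrow> 'v \<Rightarrow> real"
  assumes add_left: "B (x + y) z = B x z + B y z"
    and scale_left: "B (r *\<^sub>R x) z = r * B x z"
    and commute: "B x y = B y x"
begin

lemma add_right: "B z (x + y) = B z x + B z y"
  by (metis add_left commute)

lemma scale_right: "B z (r *\<^sub>R x) = r * B z x"
  by (metis scale_left commute)

lemma minus_left: "B (- x) z = - B x z"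
  using scale_left[of "-1" x z] by simp

lemma minus_right: "B z (- x) = - B z x"
  by (metis minus_left commute)

lemma diff_left: "B (x - y) z = B x z - B y z"
  using add_left[of x "- y" z] by (simp add: minus_left)

lemma diff_right: "B z (x - y) = B z x - B z y"
  by (metis diff_left commute)

lemmas bilinear_simps = add_left scale_left add_right scale_right minus_left minus_right
  diff_left diff_right

lemma form_reflection_add: "form_reflection B u (x + y) = form_reflection B u x + form_reflection B u y"
  by (simp add: form_reflection_def bilinear_simps algebra_simps add_divide_distrib)

lemma form_reflection_scale: "form_reflection B u (r *\<^sub>R x) = r *\<^sub>R form_reflection B u x"
  by (simp add: form_reflection_def bilinear_simps algebra_simps)

lemma form_reflection_isometry:
  assumes "B u u \<noteq> 0"
  shows "B (form_reflection B u x) (form_reflection B u y) = B x y"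
  using assms by (simp add: form_reflection_def bilinear_simps commute[of x u] field_simps)

lemma form_reflection_involution:
  assumes "B u u \<noteq> 0"
  shows "form_reflection B u (form_reflection B u x) = x"
  using assms by (simp add: form_reflection_def bilinear_simps)

lemma form_reflection_scaled:
  assumes "r \<noteq> 0"
  shows "form_reflection B (r *\<^sub>R u) = form_reflection B u"
  using assms by (simp add: form_reflection_def fun_eq_iff bilinear_simps)

end

text \<open>Only two orthonormal vectors are fixed and no definiteness is assumed: a reflection in a
  vector of the plane changes \<open>v\<close> only through the two numbers \<open>B e1 v\<close>
  and \<open>B e2 v\<close>, so identities checked on these numbers hold on the whole space.\<close>

locale orthonormal_pair = symmetric_bilinear B
  for B :: "'v::real_vector \<Rightarrow> 'v \<Rightarrow> real" +
  fixes e1 e2 :: 'v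
  assumes norm1: "B e1 e1 = 1" and norm2: "B e2 e2 = 1" and orth: "B e1 e2 = 0"
begin

lemma orth': "B e2 e1 = 0"
  using orth commute by metis

lemmas B_simps = bilinear_simps norm1 norm2 orth orth'

definition E :: "real \<Rightarrow> 'v" where
  "E t = cos t *\<^sub>R e1 + sin t *\<^sub>R e2"

lemma B_E_left: "B (E t) v = cos t * B e1 v + sin t * B e2 v"
  by (simp add: E_def B_simps)

lemma B_E: "B (E a) (E b) = cos (a - b)"
  by (simp add: E_def B_simps cos_diff)

lemma B_E_self: "B (E a) (E a) = 1"
  by (simp add: B_E)

lemma E_add_pi: "E (a + pi) = - E a"
  by (simp add: E_def)

lemma E_diff_pi: "E (a - pi) = - E a"
  by (simp add: E_def)

lemma E_add_int_pi: "E (a + of_int n * pi) = (if even n then 1 else -1) *\<^sub>R E a"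
proof -
  have c: "cos (a + of_int n * pi) = (if even n then 1 else -1) * cos a"
    by (simp add: cos_add mult.commute)
  have s: "sin (a + of_int n * pi) = (if even n then 1 else -1) * sin a"
    by (simp add: sin_add mult.commute)
  show ?thesis unfolding E_def c s by (simp add: algebra_simps)
qed

text \<open>The addition formulas for sine, in each coordinate. If
  \<open>a < b < c < a + pi\<close>, all three coefficients are positive, which puts
  \<open>E b\<close> into the cone over \<open>E a\<close> and \<open>E c\<close>; every positivity
  argument in a plane rests on this.\<close>

lemma E_interpolate: "sin (c - a) *\<^sub>R E b = sin (c - b) *\<^sub>R E a + sin (b - a) *\<^sub>R E c"
proof -
  have 1: "sin (c - a) * cos b = sin (c - b) * cos a + sin (b - a) * cos c"
    by (simp add: sin_diff algebra_simps)
  have 2: "sin (c - a) * sin b = sin (c - b) * sin a + sin (b - a) * sin c"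
    by (simp add: sin_diff algebra_simps)
  have "sin (c - a) *\<^sub>R E b = (sin (c - a) * cos b) *\<^sub>R e1 + (sin (c - a) * sin b) *\<^sub>R e2"
    by (simp add: E_def scaleR_add_right)
  also have "\<dots> = sin (c - b) *\<^sub>R E a + sin (b - a) *\<^sub>R E c"
    unfolding 1 2 by (simp add: E_def algebra_simps)
  finally show ?thesis .
qed

lemma E_parallel:
  assumes "r *\<^sub>R E a = s *\<^sub>R E b" "r \<noteq> 0"
  shows "sin (a - b) = 0"
proof -
  \<comment> \<open>The vector at angle \<open>b + pi/2\<close> is orthogonal to \<open>E b\<close>,
    so pairing with it kills the right-hand side.\<close>
  have "B (r *\<^sub>R E a) (E (b + pi/2)) = B (s *\<^sub>R E b) (E (b + pi/2))"
    using assms by simp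
  then have "r * cos (a - b - pi/2) = 0"
    by (simp add: scale_left B_E diff_diff_eq)
  moreover have "cos (a - b - pi/2) = sin (a - b)"
    by (simp add: cos_diff)
  ultimately show ?thesis using assms(2) by simp
qed

text \<open>The mirror is the line at angle \<open>a + pi/2\<close>, so angle \<open>b\<close> goes
  to \<open>2 * a - b + pi\<close>; the half turn is the minus sign.\<close>

lemma form_reflection_E_E: "form_reflection B (E a) (E b) = - E (2 * a - b)"
proof -
  have "cos b = 2 * cos (a - b) * cos a - cos (2 * a - b)"
    using cos_times_cos[of "a - b" a] by (simp add: algebra_simps)
  moreover have "sin b = 2 * cos (a - b) * sin a - sin (2 * a - b)"
    using sin_times_cos[of a "a - b"] by (simp add: algebra_simps)
  ultimately have "E b = (2 * cos (a - b) * cos a - cos (2 * a - b)) *\<^sub>R e1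
     + (2 * cos (a - b) * sin a - sin (2 * a - b)) *\<^sub>R e2"
    by (simp add: E_def)
  also have "\<dots> = (2 * cos (a - b)) *\<^sub>R E a - E (2 * a - b)"
    by (simp add: E_def algebra_simps)
  finally have "E b = (2 * cos (a - b)) *\<^sub>R E a - E (2 * a - b)" .
  then have "E b - (2 * cos (a - b)) *\<^sub>R E a = - E (2 * a - b)"
    by (subst (1) \<open>E b = _ - _\<close>) simp
  then show ?thesis
    by (simp add: form_reflection_def B_E_self B_E)
qed

lemma form_reflection_E_alt:
  "form_reflection B (E a) v = v
     + (- (cos (2*a) * B e1 v + sin (2*a) * B e2 v) - B e1 v) *\<^sub>R e1
     + (- (sin (2*a) * B e1 v - cos (2*a) * B e2 v) - B e2 v) *\<^sub>R e2"
proof -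
  have 1: "- (cos (2*a) * x + sin (2*a) * y) - x = - 2 * (cos a * x + sin a * y) * cos a" for x y
    unfolding cos_double_cos sin_double by (simp add: algebra_simps power2_eq_square)
  have 2: "- (sin (2*a) * x - cos (2*a) * y) - y = - 2 * (cos a * x + sin a * y) * sin a" for x y
    unfolding cos_double_sin sin_double by (simp add: algebra_simps power2_eq_square)
  show ?thesis
    unfolding form_reflection_def B_E_self 1 2 unfolding B_E_left
    by (simp add: E_def algebra_simps)
qed

text \<open>Two reflections compose to the rotation by \<open>2 * (a - b)\<close> of the plane. Only
  the difference of the angles enters, which is what makes products of reflections along a dihedral
  sequence comparable.\<close>

lemma form_reflection_E_twice:
  "form_reflection B (E a) (form_reflection B (E b) v) = v
     + (cos (2*(a-b)) * B e1 v - sin (2*(a-b)) * B e2 v - B e1 v) *\<^sub>R e1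
     + (sin (2*(a-b)) * B e1 v + cos (2*(a-b)) * B e2 v - B e2 v) *\<^sub>R e2"
proof -
  define x where "x = B e1 v"
  define y where "y = B e2 v"
  have x': "B e1 (form_reflection B (E b) v) = - (cos (2*b) * x + sin (2*b) * y)"
    by (simp add: form_reflection_E_alt B_simps x_def y_def)
  have y': "B e2 (form_reflection B (E b) v) = - (sin (2*b) * x - cos (2*b) * y)"
    by (simp add: form_reflection_E_alt B_simps x_def y_def)
  have ab: "2 * (a - b) = 2 * a - 2 * b" by simp
  show ?thesis
    unfolding form_reflection_E_alt[of a] x' y' ab cos_diff sin_diff
    unfolding form_reflection_E_alt[of b] x_def[symmetric] y_def[symmetric]
    by (simp add: algebra_simps)
qed

lemma form_reflection_E_involution:
  "form_reflection B (E a) (form_reflection B (E a) v) = v"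
  by (simp add: form_reflection_E_twice)

lemma form_reflection_E_rotate:
  assumes "a - b = a' - b'"
  shows "form_reflection B (E a) (form_reflection B (E b) v)
       = form_reflection B (E a') (form_reflection B (E b') v)"
  using assms by (simp add: form_reflection_E_twice)

text \<open>A power of a rotation is again a rotation, written here as a product of two reflections
  of which the second stays fixed. The power is the identity as soon as the first mirror coincides
  with the second.\<close>

lemma funpow_rotation:
  "((\<lambda>v. form_reflection B (E a) (form_reflection B (E b) v)) ^^ n) v
    = form_reflection B (E (b + real n * (a - b))) (form_reflection B (E b) v)"
proof (induction n arbitrary: v)
  case 0
  then show ?case by (simp add: form_reflection_E_involution)
next
  case (Suc n)
  let ?R = "\<lambda>a. form_reflection B (E a)"
  have "((\<lambda>v. ?R a (?R b v)) ^^ Suc n) v = ?R a (?R b (?R (b + real n * (a - b)) (?R b v)))"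
    by (simp add: Suc)
  also have "\<dots> = ?R (b + real (Suc n) * (a - b)) (?R (b + real n * (a - b))
      (?R (b + real n * (a - b)) (?R b v)))"
    by (rule form_reflection_E_rotate) (simp add: algebra_simps)
  finally show ?case by (simp add: form_reflection_E_involution)
qed

end
text \<open>Gram-Schmidt: the part \<open>b + cos p a\<close> of \<open>b\<close> orthogonal to
  \<open>a\<close> has squared norm \<open>sin p * sin p\<close>, and
  \<open>b = - cos p a + sin p e2\<close> is the point at angle \<open>pi - p\<close>.\<close>

lemma (in symmetric_bilinear) orthonormal_pair_of_angle:
  assumes "B a a = 1" "B b b = 1" "B a b = - cos p" "sin p \<noteq> 0"
  shows "\<exists>e2. orthonormal_pair B a e2 \<and> orthonormal_pair.E a e2 0 = a
    \<and> orthonormal_pair.E a e2 (pi - p) = b"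
proof (intro exI conjI)
  let ?e = "(1 / sin p) *\<^sub>R (b + cos p *\<^sub>R a)"
  have ba: "B b a = - cos p"
    using assms(3) commute by simp
  have "1 - cos p * cos p = sin p * sin p"
    using sin_cos_squared_add[of p] by (simp add: power2_eq_square)
  then have "B ?e ?e = 1"
    using assms by (simp add: bilinear_simps ba field_simps)
  then show o: "orthonormal_pair B a ?e"
    using assms by unfold_locales (simp_all add: bilinear_simps)
  show "orthonormal_pair.E a ?e 0 = a"
    by (simp add: orthonormal_pair.E_def[OF o])
  show "orthonormal_pair.E a ?e (pi - p) = b"
    using assms(4) by (simp add: orthonormal_pair.E_def[OF o])
qed

section \<open>Length and roots in Coxeter groups\<close>

lemma lookup_scaleR: "Poly_Mapping.lookup (r *\<^sub>R v) k = r *\<^sub>R Poly_Mapping.lookup v k"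
proof -
  have "finite {i. r *\<^sub>R Poly_Mapping.lookup v i \<noteq> 0}"
    by (rule finite_subset[OF _ finite_lookup[of v]]) auto
  then show ?thesis
    by (simp add: scaleR_poly_mapping_def Abs_poly_mapping_inverse)
qed

lemma word_prod_Nil [simp]: "word_prod W [] = \<one>\<^bsub>W\<^esub>"
  and word_prod_Cons [simp]: "word_prod W (x # xs) = x \<otimes>\<^bsub>W\<^esub> word_prod W xs"
  by (simp_all add: word_prod_def)

lemma (in monoid) word_prod_closed: "xs \<in> lists (carrier G) \<Longrightarrow> word_prod G xs \<in> carrier G"
  by (induction xs) auto

lemma (in monoid) word_prod_append:
  assumes "xs \<in> lists (carrier G)" "ys \<in> lists (carrier G)"
  shows "word_prod G (xs @ ys) = word_prod G xs \<otimes> word_prod G ys"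
  using assms by (induction xs) (auto simp: m_assoc word_prod_closed)

definition alternating :: "'a \<Rightarrow> 'a \<Rightarrow> nat \<Rightarrow> 'a list" where
  "alternating s t n = map (\<lambda>i. if even i then s else t) [0..<n]"

lemma alternating_0 [simp]: "alternating s t 0 = []"
  by (simp add: alternating_def)

lemma alternating_Suc: "alternating s t (Suc n) = alternating s t n @ [if even n then s else t]"
  by (simp add: alternating_def)

lemma alternating_Suc': "alternating s t (Suc n) = s # alternating t s n"
  by (induction n arbitrary: s t) (auto simp: alternating_Suc)

lemma length_alternating [simp]: "length (alternating s t n) = n"
  by (simp add: alternating_def)

lemma set_alternating: "set (alternating s t n) \<subseteq> {s, t}"
  by (auto simp: alternating_def)

section \<open>Words in the generators and the geometric representation\<close>

context finite_coxeter_system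
begin

abbreviation "B \<equiv> coxeter_form W S"
abbreviation "\<sigma> \<equiv> simple_reflection W S"
abbreviation "act \<equiv> coxeter_action W S"
abbreviation "len \<equiv> coxeter_length W S"
abbreviation "wp \<equiv> word_prod W"

lemma S_carrier: "s \<in> S \<Longrightarrow> s \<in> carrier W"
  using S_subset by auto

lemma lists_carrier: "xs \<in> lists S \<Longrightarrow> xs \<in> lists (carrier W)"
  using S_subset lists_mono by blast

lemma finite_S: "finite S"
  using finite_carrier S_subset finite_subset by blast

lemma wp_closed [simp]: "xs \<in> lists S \<Longrightarrow> wp xs \<in> carrier W"
  by (simp add: lists_carrier word_prod_closed)

lemma wp_append: "xs \<in> lists S \<Longrightarrow> ys \<in> lists S \<Longrightarrow> wp (xs @ ys) = wp xs \<otimes> wp ys"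
  by (simp add: lists_carrier word_prod_append)

lemma S_square: "s \<in> S \<Longrightarrow> s \<otimes> s = \<one>"
  using pow_ord_eq_1[of s] S_involutions[of s] S_carrier[of s] by (simp add: numeral_2_eq_2)

lemma S_inv: "s \<in> S \<Longrightarrow> inv s = s"
  using S_square S_carrier inv_equality by blast

lemma mult_S_S: "s \<in> S \<Longrightarrow> w \<in> carrier W \<Longrightarrow> w \<otimes> s \<otimes> s = w"
  using S_square S_carrier by (simp add: m_assoc)

lemma S_mult_S: "s \<in> S \<Longrightarrow> w \<in> carrier W \<Longrightarrow> s \<otimes> (s \<otimes> w) = w"
  using S_square S_carrier by (simp add: m_assoc[symmetric])

lemma wp_rev: "xs \<in> lists S \<Longrightarrow> wp (rev xs) = inv (wp xs)"
proof (induction xs)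
  case (Cons x xs)
  then have "wp (rev xs @ [x]) = wp (rev xs) \<otimes> x"
    by (subst wp_append) (auto simp: S_carrier)
  with Cons show ?case
    by (auto simp: S_inv S_carrier inv_mult_group)
qed simp

lemma wp_surj:
  assumes "w \<in> carrier W"
  shows "\<exists>xs\<in>lists S. wp xs = w"
proof -
  have "w \<in> generate W S" using assms S_generates by simp
  then show ?thesis
  proof induction
    case one
    then show ?case by (auto intro!: bexI[of _ "[]"])
  next
    case (incl h)
    then show ?case by (auto intro!: bexI[of _ "[h]"] simp: S_carrier)
  next
    case (inv h)
    then show ?case by (auto intro!: bexI[of _ "[h]"] simp: S_carrier S_inv)
  next
    case (eng h1 h2)
    then obtain xs ys where "xs \<in> lists S" "ys \<in> lists S" "wp xs = h1" "wp ys = h2" by auto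
    then show ?case by (intro bexI[of _ "xs @ ys"]) (auto simp: wp_append)
  qed
qed

lemma coxeter_order_commute:
  assumes "s \<in> S" "t \<in> S"
  shows "coxeter_order W s t = coxeter_order W t s"
proof -
  have "inv (s \<otimes> t) = t \<otimes> s"
    using assms by (simp add: inv_mult_group S_carrier S_inv)
  then show ?thesis
    using ord_inv[of "s \<otimes> t"] assms by (simp add: coxeter_order_def S_carrier)
qed

lemma coxeter_order_self: "s \<in> S \<Longrightarrow> coxeter_order W s s = 1"
  by (simp add: coxeter_order_def S_square)

lemma coxeter_order_ge_2:
  assumes "s \<in> S" "t \<in> S" "s \<noteq> t"
  shows "2 \<le> coxeter_order W s t"
proof -
  have "s \<otimes> t \<noteq> \<one>"
    using assms S_inv S_carrier inv_equality by metis
  then have "ord (s \<otimes> t) \<noteq> 1"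
    using assms S_carrier ord_eq_1 by simp
  moreover have "ord (s \<otimes> t) \<ge> 1"
    using assms S_carrier finite_carrier ord_ge_1 by simp
  ultimately show ?thesis by (simp add: coxeter_order_def)
qed

sublocale form: symmetric_bilinear B
proof
  fix x y z :: "'a \<Rightarrow>\<^sub>0 real" and r :: real
  show "B (x + y) z = B x z + B y z"
    unfolding coxeter_form_def sum.distrib[symmetric]
    by (simp only: lookup_add distrib_right)
  show "B (r *\<^sub>R x) z = r * B x z"
    by (simp add: coxeter_form_def lookup_scaleR sum_distrib_left algebra_simps)
  have "B x y = (\<Sum>t\<in>S. \<Sum>s\<in>S. Poly_Mapping.lookup x s * Poly_Mapping.lookup y t *
      (- cos (pi / real (coxeter_order W s t))))"
    unfolding coxeter_form_def by (rule sum.swap)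
  also have "\<dots> = B y x"
    unfolding coxeter_form_def
    by (rule sum.cong[OF HOL.refl])+ (simp add: coxeter_order_commute)
  finally show "B x y = B y x" .
qed

lemma B_basis:
  assumes "s \<in> S" "t \<in> S"
  shows "B (basis_root s) (basis_root t) = - cos (pi / real (coxeter_order W s t))"
proof -
  have "B (basis_root s) (basis_root t)
    = (\<Sum>s'\<in>S. \<Sum>t'\<in>S. if t' = t then if s' = s then - cos (pi / real (coxeter_order W s t)) else 0 else 0)"
    unfolding coxeter_form_def
    by (rule sum.cong[OF HOL.refl])+ (auto simp: basis_root_def lookup_single when_def)
  then show ?thesis
    using assms finite_S by (simp add: sum.delta)
qed

lemma B_basis_self: "s \<in> S \<Longrightarrow> B (basis_root s) (basis_root s) = 1"
  by (simp add: B_basis coxeter_order_self)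

lemma simple_reflection_eq: "s \<in> S \<Longrightarrow> \<sigma> s = form_reflection B (basis_root s)"
  by (simp add: fun_eq_iff simple_reflection_def form_reflection_def B_basis_self)

lemma simple_reflection_involution: "s \<in> S \<Longrightarrow> \<sigma> s (\<sigma> s v) = v"
  by (simp add: simple_reflection_eq form.form_reflection_involution B_basis_self)

lemma foldr_simple_linear:
  assumes "xs \<in> lists S"
  shows "foldr \<sigma> xs (x + y) = foldr \<sigma> xs x + foldr \<sigma> xs y"
    and "foldr \<sigma> xs (r *\<^sub>R x) = r *\<^sub>R foldr \<sigma> xs x"
    and "B (foldr \<sigma> xs x) (foldr \<sigma> xs y) = B x y"
  using assms
  by (induction xs) (auto simp: simple_reflection_eq form.form_reflection_add
      form.form_reflection_scale form.form_reflection_isometry B_basis_self)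

lemma dihedral_plane:
  assumes "s \<in> S" "t \<in> S" "s \<noteq> t"
  defines "p \<equiv> pi / real (coxeter_order W s t)"
  obtains e2 where "orthonormal_pair B (basis_root s) e2"
    "orthonormal_pair.E (basis_root s) e2 0 = basis_root s"
    "orthonormal_pair.E (basis_root s) e2 (pi - p) = basis_root t"
    "0 < sin p"
proof -
  have "2 \<le> coxeter_order W s t" using assms(1-3) by (rule coxeter_order_ge_2)
  then have "0 < p" "p < pi" by (simp_all add: p_def field_simps)
  then have "0 < sin p" by (rule sin_gt_zero)
  then show ?thesis
    using form.orthonormal_pair_of_angle[of "basis_root s" "basis_root t" p] that assms
    by (auto simp: B_basis_self B_basis)
qed

lemma foldr_alternating_pairs:
  "foldr \<sigma> (concat (replicate n [s, t])) = ((\<lambda>v. \<sigma> s (\<sigma> t v)) ^^ n)"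
  by (induction n) auto

lemma simple_reflections_braid:
  assumes "s \<in> S" "t \<in> S"
  shows "foldr \<sigma> (concat (replicate (coxeter_order W s t) [s, t])) = id"
proof (cases "s = t")
  case True
  then show ?thesis
    using assms by (simp add: coxeter_order_self fun_eq_iff simple_reflection_involution)
next
  case False
  define m where "m = coxeter_order W s t"
  have m: "2 \<le> m" using assms False by (simp add: m_def coxeter_order_ge_2)
  obtain e2 where o: "orthonormal_pair B (basis_root s) e2"
    and s: "orthonormal_pair.E (basis_root s) e2 0 = basis_root s"
    and t: "orthonormal_pair.E (basis_root s) e2 (pi - pi / real m) = basis_root t"
    using dihedral_plane[OF assms False] m_def by metis
  interpret o: orthonormal_pair B "basis_root s" e2 by (rule o)
  let ?a = "pi - pi / real m"
  have "((\<lambda>v. \<sigma> s (\<sigma> t v)) ^^ m) v = v" for v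
  proof -
    \<comment> \<open>As \<open>m * ?a = (m - 1) * pi\<close>, the mirror vector reached after
      \<open>m\<close> turns is the old one up to sign, and a reflection does not see that
      sign.\<close>
    have "?a + real m * (0 - ?a) = ?a + of_int (1 - int m) * pi"
      using m by (simp add: field_simps)
    then have "form_reflection B (o.E (?a + real m * (0 - ?a))) = form_reflection B (o.E ?a)"
      using form.form_reflection_scaled[of "-1" "o.E ?a"] by (simp only: o.E_add_int_pi) simp
    then show ?thesis
      using o.funpow_rotation[where a=0 and b = ?a and n = m and v = v] assms
      by (simp add: s t simple_reflection_eq form.form_reflection_involution B_basis_self)
  qed
  then show ?thesis
    by (simp add: foldr_alternating_pairs m_def[symmetric] fun_eq_iff)
qed

text \<open>The two invariants of words that respect the Coxeter relations.
  \<open>S_presentation\<close> enters the proof only together with this lemma: once to make the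
  action independent of the chosen word, once to give the length a parity.\<close>

lemma coxeter_cong_sound:
  assumes "coxeter_cong W S xs ys"
  shows "foldr \<sigma> xs = foldr \<sigma> ys \<and> (even (length xs) \<longleftrightarrow> even (length ys))"
  using assms
proof induction
  case (rel s t xs ys)
  have "even (length (concat (replicate n [s, t])))" for n
    by (induction n) auto
  then show ?case
    using simple_reflections_braid[OF rel(1,2)] by simp
qed auto

lemma act_wp: "xs \<in> lists S \<Longrightarrow> act (wp xs) = foldr \<sigma> xs"
proof -
  assume xs: "xs \<in> lists S"
  let ?P = "\<lambda>ys. ys \<in> lists S \<and> wp ys = wp xs"
  have "?P (SOME ys. ?P ys)"
    by (rule someI[of ?P xs]) (use xs in simp)
  then have "foldr \<sigma> (SOME ys. ?P ys) = foldr \<sigma> xs"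
    using S_presentation[OF _ xs] coxeter_cong_sound by blast
  then show ?thesis by (simp add: coxeter_action_def fun_eq_iff)
qed

lemma
  assumes "w \<in> carrier W"
  shows act_add: "act w (x + y) = act w x + act w y"
    and act_scale: "act w (r *\<^sub>R x) = r *\<^sub>R act w x"
    and act_isometry: "B (act w x) (act w y) = B x y"
proof -
  obtain xs where xs: "xs \<in> lists S" "wp xs = w"
    using wp_surj[OF assms] by blast
  then have "act w = foldr \<sigma> xs"
    using act_wp by blast
  then show "act w (x + y) = act w x + act w y" "act w (r *\<^sub>R x) = r *\<^sub>R act w x"
    "B (act w x) (act w y) = B x y"
    by (simp_all only: foldr_simple_linear[OF xs(1)])
qed

lemma act_minus: "w \<in> carrier W \<Longrightarrow> act w (- x) = - act w x"
  using act_scale[of w "-1" x] by simp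

lemma act_diff: "w \<in> carrier W \<Longrightarrow> act w (x - y) = act w x - act w y"
  using act_add[of w x "- y"] by (simp add: act_minus)

lemma act_mult: "v \<in> carrier W \<Longrightarrow> w \<in> carrier W \<Longrightarrow> act (v \<otimes> w) x = act v (act w x)"
proof -
  assume "v \<in> carrier W" "w \<in> carrier W"
  then obtain xs ys where "xs \<in> lists S" "ys \<in> lists S" "wp xs = v" "wp ys = w"
    using wp_surj by metis
  then show ?thesis
    using act_wp[of "xs @ ys"] act_wp[of xs] act_wp[of ys] by (simp add: wp_append)
qed

lemma act_one: "act \<one> x = x"
  using act_wp[of "[]"] by simp

lemma act_S: "s \<in> S \<Longrightarrow> act s = form_reflection B (basis_root s)"
  using act_wp[of "[s]"] by (simp add: S_carrier simple_reflection_eq fun_eq_iff)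

lemma act_inv_act: "w \<in> carrier W \<Longrightarrow> act (inv w) (act w x) = x"
  and act_act_inv: "w \<in> carrier W \<Longrightarrow> act w (act (inv w) x) = x"
  by (simp_all add: act_mult[symmetric] act_one)

section \<open>The length function and its parity\<close>

lemma len_wp_le: "xs \<in> lists S \<Longrightarrow> len (wp xs) \<le> length xs"
  unfolding coxeter_length_def by (rule Least_le) auto

lemma len_attained:
  assumes "w \<in> carrier W"
  obtains xs where "xs \<in> lists S" "wp xs = w" "length xs = len w"
proof -
  let ?P = "\<lambda>n. \<exists>xs\<in>lists S. length xs = n \<and> wp xs = w"
  have "\<exists>n. ?P n" using wp_surj[OF assms] by auto
  then have "?P (LEAST n. ?P n)" by (rule LeastI_ex)
  then show ?thesis using that unfolding coxeter_length_def by blast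
qed

text \<open>A reduced word and any other word for the same element are congruent, so their lengths
  agree modulo 2. Parity later rules out equal lengths when \<open>w\<close> is compared with
  \<open>w\<close> times a reflection.\<close>

lemma even_len_wp:
  assumes "xs \<in> lists S"
  shows "even (len (wp xs)) \<longleftrightarrow> even (length xs)"
proof -
  obtain ys where "ys \<in> lists S" "wp ys = wp xs" "length ys = len (wp xs)"
    using len_attained[of "wp xs"] assms by auto
  then show ?thesis
    using S_presentation[of ys xs] assms coxeter_cong_sound[of ys xs] by auto
qed

lemma even_len_mult:
  assumes "v \<in> carrier W" "w \<in> carrier W"
  shows "even (len (v \<otimes> w)) \<longleftrightarrow> (even (len v) \<longleftrightarrow> even (len w))"
proof -
  obtain xs ys where "xs \<in> lists S" "ys \<in> lists S" "wp xs = v" "wp ys = w"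
    using assms wp_surj by metis
  then show ?thesis
    using even_len_wp[of "xs @ ys"] even_len_wp[of xs] even_len_wp[of ys] by (auto simp: wp_append)
qed

lemma odd_len_S: "s \<in> S \<Longrightarrow> odd (len s)"
  using even_len_wp[of "[s]"] S_carrier by simp

lemma len_mult_le:
  assumes "v \<in> carrier W" "w \<in> carrier W"
  shows "len (v \<otimes> w) \<le> len v + len w"
proof -
  obtain xs ys where "xs \<in> lists S" "ys \<in> lists S" "wp xs = v" "wp ys = w"
     "length xs = len v" "length ys = len w"
    using assms len_attained by metis
  then show ?thesis
    using len_wp_le[of "xs @ ys"] by (auto simp: wp_append)
qed

lemma len_S_le: "s \<in> S \<Longrightarrow> len s \<le> 1"
  using len_wp_le[of "[s]"] S_carrier by simp

lemma len_mult_S: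
  assumes "w \<in> carrier W" "s \<in> S"
  shows "len (w \<otimes> s) = len w + 1 \<or> len w = len (w \<otimes> s) + 1"
proof -
  have "len (w \<otimes> s) \<le> len w + 1"
    using len_mult_le[of w s] len_S_le[of s] assms S_carrier by fastforce
  moreover have "len w \<le> len (w \<otimes> s) + 1"
    using len_mult_le[of "w \<otimes> s" s] len_S_le[of s] assms S_carrier
    by (fastforce simp: mult_S_S)
  moreover have "len (w \<otimes> s) \<noteq> len w"
    using even_len_mult[of w s] odd_len_S[of s] assms S_carrier by metis
  ultimately show ?thesis by linarith
qed

lemma exists_left_descent:
  assumes "w \<in> carrier W" "w \<noteq> \<one>"
  obtains s where "s \<in> S" "len w = len (s \<otimes> w) + 1"
proof -
  obtain xs where xs: "xs \<in> lists S" "wp xs = w" "length xs = len w"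
    using assms len_attained by metis
  then obtain s ys where ys: "xs = s # ys" using assms by (cases xs) auto
  then have "s \<in> S" "ys \<in> lists S"
    using xs(1) by simp_all
  then have s: "s \<in> S" "ys \<in> lists S" "s \<otimes> w = wp ys"
    using xs ys S_mult_S[of s "wp ys"] by simp_all
  have "len (s \<otimes> w) + 1 \<le> len w"
    using len_wp_le[of ys] s xs ys by auto
  moreover have "len w \<le> 1 + len (s \<otimes> w)"
    using len_mult_le[of s "s \<otimes> w"] len_S_le[of s] s assms S_carrier S_mult_S by fastforce
  ultimately show ?thesis using that s by force
qed

lemma exists_right_descent:
  assumes "w \<in> carrier W" "w \<noteq> \<one>"
  obtains s where "s \<in> S" "len w = len (w \<otimes> s) + 1"
proof -
  obtain xs where xs: "xs \<in> lists S" "wp xs = w" "length xs = len w"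
    using assms len_attained by metis
  then obtain s ys where ys: "xs = ys @ [s]" using assms by (cases xs rule: rev_cases) auto
  then have "s \<in> S" "ys \<in> lists S"
    using xs(1) by simp_all
  then have s: "s \<in> S" "ys \<in> lists S" "w \<otimes> s = wp ys"
    using xs ys mult_S_S[of s "wp ys"] S_carrier wp_append[of ys "[s]"] by simp_all
  have "len (w \<otimes> s) + 1 \<le> len w"
    using len_wp_le[of ys] s xs ys by auto
  then show ?thesis using that s len_mult_S[OF assms(1) s(1)] by force
qed

section \<open>Positivity of roots\<close>

definition nonneg :: "('a \<Rightarrow>\<^sub>0 real) \<Rightarrow> bool" where
  "nonneg v \<longleftrightarrow> (\<forall>s\<in>S. 0 \<le> Poly_Mapping.lookup v s)"

lemma nonneg_add: "nonneg x \<Longrightarrow> nonneg y \<Longrightarrow> nonneg (x + y)"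
  by (auto simp: nonneg_def lookup_add)

lemma nonneg_scale: "0 \<le> r \<Longrightarrow> nonneg x \<Longrightarrow> nonneg (r *\<^sub>R x)"
  by (auto simp: nonneg_def lookup_scaleR)

lemma nonneg_scale_iff: "0 < r \<Longrightarrow> nonneg (r *\<^sub>R x) \<longleftrightarrow> nonneg x"
  by (auto simp: nonneg_def lookup_scaleR zero_le_mult_iff)

lemma nonneg_basis: "nonneg (basis_root s)"
  by (auto simp: nonneg_def basis_root_def lookup_single when_def)

text \<open>The word is arranged so that \<open>t\<close> acts first, then \<open>s\<close>, and so
  on. Each letter reflects the angle, either at \<open>pi - p\<close> or at 0. For
  \<open>(n + 1) * p \<le> pi\<close> the result lies between the angles 0 and \<open>pi - p\<close>
  of the two simple roots.\<close>

lemma act_alternating: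
  assumes s: "s \<in> S" and t: "t \<in> S" and o: "orthonormal_pair B (basis_root s) e2"
    and E0: "orthonormal_pair.E (basis_root s) e2 0 = basis_root s"
    and Et: "orthonormal_pair.E (basis_root s) e2 (pi - p) = basis_root t"
  shows "foldr \<sigma> (rev (alternating t s n)) (basis_root s) = orthonormal_pair.E (basis_root s) e2
    (if even n then real n * p else pi - real (n + 1) * p)"
proof (induction n)
  case 0
  then show ?case by (simp add: E0)
next
  case (Suc n)
  interpret o: orthonormal_pair B "basis_root s" e2 by (rule o)
  show ?case
  proof (cases "even n")
    case True
    have "foldr \<sigma> (rev (alternating t s (Suc n))) (basis_root s)
        = form_reflection B (o.E (pi - p)) (o.E (real n * p))"
      using Suc True t by (simp add: alternating_Suc Et simple_reflection_eq)
    also have "\<dots> = - o.E ((pi - real (Suc n + 1) * p) + pi)"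
      by (simp add: o.form_reflection_E_E algebra_simps)
    also have "\<dots> = o.E (pi - real (Suc n + 1) * p)"
      by (simp only: o.E_add_pi minus_minus)
    finally show ?thesis using True by simp
  next
    case False
    have "foldr \<sigma> (rev (alternating t s (Suc n))) (basis_root s)
        = form_reflection B (o.E 0) (o.E (pi - real (n + 1) * p))"
      using Suc False s by (simp add: alternating_Suc E0 simple_reflection_eq)
    also have "\<dots> = - o.E (real (Suc n) * p - pi)"
      by (simp add: o.form_reflection_E_E algebra_simps)
    also have "\<dots> = o.E (real (Suc n) * p)"
      by (simp only: o.E_diff_pi minus_minus)
    finally show ?thesis using False by simp
  qed
qed

lemma wp_alternating_full:
  assumes "s \<in> S" "t \<in> S"
  shows "wp (alternating s t (2 * coxeter_order W s t)) = \<one>"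
proof -
  have "wp (alternating s t (2 * n)) = (s \<otimes> t) [^] n" for n
  proof (induction n)
    case (Suc n)
    have "alternating s t (2 * Suc n) = alternating s t (2 * n) @ [s, t]"
      by (simp add: alternating_Suc)
    moreover have "alternating s t (2 * n) \<in> lists S"
      using set_alternating assms by fastforce
    ultimately show ?case
      using Suc assms wp_append[of "alternating s t (2 * n)" "[s, t]"] by (simp add: S_carrier)
  qed simp
  then show ?thesis
    using pow_ord_eq_1[of "s \<otimes> t"] assms by (simp add: coxeter_order_def S_carrier)
qed

text \<open>Strip letters \<open>t\<close>, \<open>s\<close>, \<open>t\<close>, \dots from the right of \<open>w\<close> as long as the length drops. The
  remaining element is minimal in its coset of \<open>\<langle>s, t\<rangle>\<close>, so that the induction hypothesis applies to
  it, and the stripped part has fewer than \<open>m(s,t)\<close> letters, so that it maps \<open>\<alpha>\<^sub>s\<close> to a nonnegative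
  combination of \<open>\<alpha>\<^sub>s\<close> and \<open>\<alpha>\<^sub>t\<close>.\<close>

lemma nonneg_act_simple:
  assumes "w \<in> carrier W" "s \<in> S" "len (w \<otimes> s) = len w + 1"
  shows "nonneg (act w (basis_root s))"
  using assms
proof (induction "len w" arbitrary: w s rule: less_induct)
  case less
  note w = less.prems(1) and s = less.prems(2) and ws = less.prems(3)
  show ?case
  proof (cases "w = \<one>")
    case True
    then show ?thesis by (simp add: act_one nonneg_basis)
  next
    case False
    obtain t where t: "t \<in> S" "len w = len (w \<otimes> t) + 1"
      using exists_right_descent[OF w False] .
    have ts: "s \<noteq> t" using t ws by auto
    define m where "m = coxeter_order W s t"
    have m2: "2 \<le> m" using s t(1) ts by (simp add: m_def coxeter_order_ge_2)
    define A where "A n = alternating t s n" for n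
    define r where "r n = (if even n then t else s)" for n :: nat
    define v where "v n = w \<otimes> wp (A n)" for n
    have A: "A n \<in> lists S" for n
      using set_alternating[of t s n] s t(1) by (auto simp: A_def)
    have v: "v n \<in> carrier W" for n
      using w A by (simp add: v_def)
    have r: "r n \<in> S" for n using s t(1) by (simp add: r_def)
    have A_Suc: "A (Suc n) = A n @ [r n]" for n
      by (simp add: A_def r_def alternating_Suc)
    have v_Suc: "v (Suc n) = v n \<otimes> r n" for n
      using w A[of n] r[of n] S_carrier[OF r[of n]] wp_append[of "A n" "[r n]"]
      by (simp add: v_def A_Suc m_assoc)
    have v0: "v 0 = w" using w by (simp add: v_def A_def)
    define P where "P n \<longleftrightarrow> len (v n) + n = len w" for n
    \<comment> \<open>The number of letters stripped before the length first fails to drop; it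
      exists because the length cannot drop more than \<open>len w\<close> times.\<close>
    define n where "n = (LEAST n. \<not> P (Suc n))"
    have "\<not> P (Suc (len w))" by (simp add: P_def)
    then have nP: "\<not> P (Suc n)" unfolding n_def by (rule LeastI)
    have P: "P i" if "i \<le> n" for i
    proof (cases i)
      case 0
      then show ?thesis by (simp add: P_def v0)
    next
      case (Suc j)
      then have "j < n" using that by simp
      then show ?thesis unfolding n_def using Suc not_less_Least by blast
    qed
    have "P 1" using t v_Suc[of 0] v0 by (simp add: P_def r_def)
    then have n1: "n \<noteq> 0" using nP by (intro notI) simp
    then obtain k where k: "n = Suc k" by (cases n) auto
    have up: "len (v n \<otimes> r n) = len (v n) + 1"
      using len_mult_S[OF v r, of n n] nP P[of n] by (auto simp: P_def v_Suc)
    \<comment> \<open>Both \<open>r n\<close> (the next letter) and \<open>r k\<close> (the last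
      stripped one, put back) raise the length of \<open>v n\<close>. They are \<open>s\<close> and
      \<open>t\<close> in some order, so \<open>v n\<close> has no descent in either.\<close>
    have "v n \<otimes> r k = v k"
      using k v r by (simp add: v_Suc mult_S_S)
    then have up': "len (v n \<otimes> r k) = len (v n) + 1"
      using P[of n] P[of k] k by (simp add: P_def)
    have "nonneg (act (v n) (basis_root (r n)))" "nonneg (act (v n) (basis_root (r k)))"
      using less.hyps[OF _ v r] up up' P[of n] n1 by (auto simp: P_def)
    then have pos: "nonneg (act (v n) (basis_root s))" "nonneg (act (v n) (basis_root t))"
      by (auto simp: r_def k split: if_splits)
    \<comment> \<open>With \<open>m\<close> stripped letters, \<open>w s\<close> would be
      \<open>v m\<close> times the inverse of the word \<open>s # A m\<close> of
      \<open>m + 1\<close> letters. As \<open>(s t)^m = 1\<close>, that inverse also has a word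
      \<open>ys\<close> of \<open>m - 1\<close> letters, so \<open>w s\<close> would be shorter than
      \<open>w\<close>.\<close>
    have nm: "n < m"
    proof (rule ccontr)
      assume "\<not> n < m"
      then have Pm: "P m" using P by simp
      define ys where "ys = drop (Suc m) (alternating s t (2 * m))"
      define xs where "xs = take (Suc m) (alternating s t (2 * m))"
      have "xs = take (Suc m) (map (\<lambda>i. if even i then s else t) [0..<2*m])"
        by (simp add: xs_def alternating_def)
      also have "\<dots> = alternating s t (Suc m)"
        using m2 by (simp add: take_map alternating_def)
      finally have xs: "xs = s # A m" by (simp add: alternating_Suc' A_def)
      have xy: "xs @ ys = alternating s t (2 * m)" by (simp add: xs_def ys_def)
      moreover have "alternating s t (2 * m) \<in> lists S"
        using set_alternating[of s t "2 * m"] s t(1) by auto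
      ultimately have l: "xs \<in> lists S" "ys \<in> lists S"
        by (metis append_in_lists_conv)+
      have "wp xs \<otimes> wp ys = \<one>"
        using wp_append[OF l] xy wp_alternating_full[OF s t(1)] by (simp add: m_def)
      then have "wp ys = inv (wp xs)"
        using l by (metis inv_equality inv_inv wp_closed)
      also have "\<dots> = inv (wp (A m)) \<otimes> s"
        using A s by (simp add: xs inv_mult_group S_carrier S_inv)
      finally have ys: "wp ys = inv (wp (A m)) \<otimes> s" .
      have "v m \<otimes> inv (wp (A m)) = w"
        using w wp_closed[OF A[of m]] by (simp add: v_def m_assoc)
      then have "v m \<otimes> wp ys = w \<otimes> s"
        unfolding ys using v wp_closed[OF A[of m]] S_carrier[OF s] by (metis m_assoc inv_closed)
      then have "len (w \<otimes> s) \<le> len (v m) + len (wp ys)"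
        using len_mult_le[of "v m" "wp ys"] v l by simp
      also have "\<dots> \<le> len (v m) + (m - 1)"
        using len_wp_le[OF l(2)] by (simp add: ys_def)
      finally show False using Pm ws m2 by (simp add: P_def)
    qed
    define p where "p = pi / real m"
    obtain e2 where o: "orthonormal_pair B (basis_root s) e2"
      and E0: "orthonormal_pair.E (basis_root s) e2 0 = basis_root s"
      and Et: "orthonormal_pair.E (basis_root s) e2 (pi - p) = basis_root t"
      and p: "0 < sin p"
      using dihedral_plane[OF s t(1) ts] unfolding p_def m_def by metis
    interpret o: orthonormal_pair B "basis_root s" e2 by (rule o)
    define b where "b = (if even n then real n * p else pi - real (n + 1) * p)"
    have pm: "p > 0" "real m * p = pi" using m2 by (simp_all add: p_def)
    have "real (n + 1) * p \<le> real m * p"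
      using nm pm by (intro mult_right_mono) auto
    then have np: "real n * p + p \<le> pi" using pm by (simp add: algebra_simps)
    have np0: "0 \<le> real n * p" using pm by simp
    have b: "0 \<le> b" "b \<le> pi - p"
      using np np0 by (auto simp: b_def algebra_simps)
    have rA: "rev (A n) \<in> lists S" using A[of n] by auto
    have "w = v n \<otimes> wp (rev (A n))"
      using w wp_closed[OF A[of n]] by (simp add: v_def wp_rev[OF A] m_assoc)
    then have "act w (basis_root s) = act (v n) (act (wp (rev (A n))) (basis_root s))"
      using act_mult[OF v[of n] wp_closed[OF rA]] by simp
    also have "act (wp (rev (A n))) (basis_root s) = o.E b"
      using act_wp[OF rA] act_alternating[OF s t(1) o E0 Et]
      by (simp add: A_def b_def)
    finally have w_eq: "act w (basis_root s) = act (v n) (o.E b)" .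
    \<comment> \<open>Interpolation between the simple roots at angles 0 and \<open>pi - p\<close>;
      \<open>n < m\<close> has placed \<open>b\<close> in this range, so both coefficients are
      nonnegative.\<close>
    have "sin p *\<^sub>R act w (basis_root s) = act (v n) (sin (pi - p - 0) *\<^sub>R o.E b)"
      using v by (simp add: w_eq act_scale)
    also have "\<dots> = sin (pi - p - b) *\<^sub>R act (v n) (basis_root s)
        + sin b *\<^sub>R act (v n) (basis_root t)"
      using v by (simp only: o.E_interpolate act_add act_scale E0 Et) simp
    finally have "sin p *\<^sub>R act w (basis_root s) = \<dots>" .
    moreover have "nonneg \<dots>"
      using pos b pm by (intro nonneg_add nonneg_scale sin_ge_zero) auto
    ultimately show ?thesis
      using nonneg_scale_iff[OF p] by metis
  qed
qed

lemma simple_act_basis: "s \<in> S \<Longrightarrow> act s (basis_root s) = - basis_root s"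
  by (simp add: act_S form_reflection_def B_basis_self scaleR_2)

lemma nonneg_act_basis_cases:
  assumes "w \<in> carrier W" "s \<in> S"
  shows "nonneg (act w (basis_root s)) \<or> nonneg (- act w (basis_root s))"
proof (cases "len (w \<otimes> s) = len w + 1")
  case True
  then show ?thesis using assms nonneg_act_simple by blast
next
  case False
  then have "len ((w \<otimes> s) \<otimes> s) = len (w \<otimes> s) + 1"
    using len_mult_S[OF assms] assms by (simp add: mult_S_S)
  then have "nonneg (act (w \<otimes> s) (basis_root s))"
    using assms S_carrier by (intro nonneg_act_simple) auto
  then show ?thesis
    using assms by (simp add: act_mult S_carrier simple_act_basis act_minus)
qed

lemma nonneg_both:
  assumes "nonneg v" "nonneg (- v)"
  shows "B v v = 0"
proof -
  have "Poly_Mapping.lookup v s = 0" if "s \<in> S" for s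
    using assms that unfolding nonneg_def by fastforce
  then show ?thesis by (simp add: coxeter_form_def)
qed

text \<open>A nontrivial \<open>w\<close> has a right descent \<open>s\<close>, and then
  \<open>w\<close> sends the simple root of \<open>s\<close> to a vector with nonpositive
  coordinates, which cannot be that root itself.\<close>

lemma act_faithful:
  assumes "w \<in> carrier W" "\<And>s. s \<in> S \<Longrightarrow> act w (basis_root s) = basis_root s"
  shows "w = \<one>"
proof (rule ccontr)
  assume "w \<noteq> \<one>"
  then obtain s where s: "s \<in> S" "len w = len (w \<otimes> s) + 1"
    using exists_right_descent assms(1) by blast
  then have "len ((w \<otimes> s) \<otimes> s) = len (w \<otimes> s) + 1"
    using assms(1) by (simp add: mult_S_S)
  then have "nonneg (act (w \<otimes> s) (basis_root s))"
    using assms(1) s S_carrier by (intro nonneg_act_simple) auto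
  then have "nonneg (- basis_root s)"
    using assms s by (simp add: act_mult S_carrier simple_act_basis act_minus)
  then show False
    using nonneg_both[OF nonneg_basis] B_basis_self s(1) by force
qed

text \<open>The bridge from geometry to the group: identities between products of reflections are
  checked on simple roots and transferred to \<open>W\<close> by faithfulness.\<close>

lemma act_eq_imp_eq:
  assumes "v \<in> carrier W" "w \<in> carrier W"
    "\<And>s. s \<in> S \<Longrightarrow> act v (basis_root s) = act w (basis_root s)"
  shows "v = w"
proof -
  have "inv w \<otimes> v = \<one>"
    using assms by (intro act_faithful) (simp_all add: act_mult act_inv_act)
  then show ?thesis
    using assms inv_equality inv_inv by (metis inv_closed)
qed

lemma act_form_reflection:
  assumes "w \<in> carrier W"
  shows "act w (form_reflection B v x) = form_reflection B (act w v) (act w x)"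
  using assms by (simp add: form_reflection_def act_diff act_scale act_isometry)

lemma act_coxeter_space:
  assumes "w \<in> carrier W" "v \<in> coxeter_space S"
  shows "act w v \<in> coxeter_space S"
proof -
  obtain xs where xs: "xs \<in> lists S" "wp xs = w" using wp_surj[OF assms(1)] by blast
  have "foldr \<sigma> xs v \<in> coxeter_space S"
    using xs(1)
  proof (induction xs)
    case (Cons s xs)
    then have "foldr \<sigma> xs v \<in> coxeter_space S" by auto
    then have "Poly_Mapping.lookup (foldr \<sigma> xs v) k = 0" if "k \<notin> S" for k
      using that by (force simp: coxeter_space_def in_keys_iff)
    then show ?case
      using Cons by (auto simp: coxeter_space_def simple_reflection_def in_keys_iff lookup_minus
          lookup_scaleR basis_root_def lookup_single when_def split: if_splits)
  qed (use assms in simp)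
  then show ?thesis using act_wp[OF xs(1)] xs(2) by simp
qed

lemma basis_coxeter_space: "s \<in> S \<Longrightarrow> basis_root s \<in> coxeter_space S"
  by (simp add: coxeter_space_def basis_root_def)

end

section \<open>Normalized roots and the reflections in them\<close>

locale normalized_coxeter_system = finite_coxeter_system +
  fixes c :: "'a \<Rightarrow> real"
  assumes normalization: "root_normalization W S c"
begin

abbreviation "\<Delta> \<equiv> roots W S c"
abbreviation "\<Delta>p \<equiv> pos_roots W S c"
abbreviation "refl_of \<equiv> root_reflection W S"

lemma c_pos: "s \<in> S \<Longrightarrow> 0 < c s"
  using normalization by (simp add: root_normalization_def)

lemma rootE:
  assumes "v \<in> \<Delta>"
  obtains w s where "w \<in> carrier W" "s \<in> S" "v = c s *\<^sub>R act w (basis_root s)"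
  using assms by (auto simp: roots_def act_scale)

lemma rootI: "w \<in> carrier W \<Longrightarrow> s \<in> S \<Longrightarrow> c s *\<^sub>R act w (basis_root s) \<in> \<Delta>"
  by (auto simp: roots_def act_scale[symmetric])

lemma act_root:
  assumes "v \<in> \<Delta>" "w \<in> carrier W"
  shows "act w v \<in> \<Delta>"
proof -
  obtain u s where "u \<in> carrier W" "s \<in> S" "v = c s *\<^sub>R act u (basis_root s)"
    using assms(1) by (rule rootE)
  then show ?thesis
    using rootI[of "w \<otimes> u" s] assms(2) by (simp add: act_mult act_scale)
qed

lemma uminus_root:
  assumes "v \<in> \<Delta>"
  shows "- v \<in> \<Delta>"
proof -
  obtain w s where "w \<in> carrier W" "s \<in> S" "v = c s *\<^sub>R act w (basis_root s)"
    using assms(1) by (rule rootE)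
  then show ?thesis
    using rootI[of "w \<otimes> s" s] by (simp add: act_mult S_carrier simple_act_basis act_minus)
qed

lemma root_norm:
  assumes "v \<in> \<Delta>"
  shows "0 < B v v"
proof -
  obtain w s where "w \<in> carrier W" "s \<in> S" "v = c s *\<^sub>R act w (basis_root s)"
    using assms(1) by (rule rootE)
  then show ?thesis
    using c_pos by (simp add: form.bilinear_simps act_isometry B_basis_self)
qed

lemma root_coxeter_space:
  assumes "v \<in> \<Delta>"
  shows "v \<in> coxeter_space S"
proof -
  obtain w s where ws: "w \<in> carrier W" "s \<in> S" "v = c s *\<^sub>R act w (basis_root s)"
    using assms(1) by (rule rootE)
  have "act w (basis_root s) \<in> coxeter_space S"
    using act_coxeter_space[OF ws(1) basis_coxeter_space[OF ws(2)]] .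
  then show ?thesis
    by (auto simp: ws(3) coxeter_space_def in_keys_iff lookup_scaleR)
qed

lemma root_cases:
  assumes "v \<in> \<Delta>"
  shows "nonneg v \<or> nonneg (- v)"
proof -
  obtain w s where *: "w \<in> carrier W" "s \<in> S" "v = c s *\<^sub>R act w (basis_root s)"
    using assms(1) by (rule rootE)
  then show ?thesis
    using nonneg_act_basis_cases[of w s] nonneg_scale[of "c s"] c_pos[of s]
    by (metis less_imp_le scaleR_minus_right)
qed

lemma nonneg_uminus_root: "v \<in> \<Delta> \<Longrightarrow> nonneg (- v) \<longleftrightarrow> \<not> nonneg v"
  using root_cases[of v] nonneg_both[of v] root_norm[of v] by auto

lemma pos_root_iff: "v \<in> \<Delta>p \<longleftrightarrow> v \<in> \<Delta> \<and> nonneg v"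
  by (auto simp: pos_roots_def nonneg_def)

text \<open>The reflection in a multiple of \<open>w(\<alpha>_s)\<close> is the conjugate of
  \<open>s\<close> by \<open>w\<close>, and conjugation keeps the odd parity of
  \<open>s\<close>.\<close>

lemma reflection_ex:
  assumes "v \<in> \<Delta>"
  shows "\<exists>r\<in>carrier W. act r = form_reflection B v \<and> odd (len r)"
proof -
  obtain w s where ws: "w \<in> carrier W" "s \<in> S" "v = c s *\<^sub>R act w (basis_root s)"
    using assms(1) by (rule rootE)
  let ?r = "w \<otimes> s \<otimes> inv w"
  have "act ?r x = form_reflection B v x" for x
    using ws c_pos[of s] act_form_reflection[of w "basis_root s" "act (inv w) x"]
    by (simp add: act_mult S_carrier act_S form.form_reflection_scaled act_act_inv)
  moreover have "even (len w) = even (len (inv w))"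
    using even_len_mult[of w "inv w"] even_len_wp[of "[]"] ws by simp
  then have "odd (len ?r)"
    using even_len_mult[of "w \<otimes> s" "inv w"] even_len_mult[of w s] odd_len_S[of s] ws S_carrier
    by auto
  ultimately show ?thesis
    using ws S_carrier by (intro bexI[of _ ?r]) (auto simp: fun_eq_iff)
qed

text \<open>Evaluates the definite description in \<open>root_reflection\<close>. Agreement on the
  simple roots is enough: some element acts as the reflection everywhere, and faithfulness
  identifies it with \<open>r\<close>.\<close>

lemma reflection_unique:
  assumes "v \<in> \<Delta>" "r \<in> carrier W"
    "\<And>s. s \<in> S \<Longrightarrow> act r (basis_root s) = form_reflection B v (basis_root s)"
  shows "refl_of v = r"
  unfolding root_reflection_def
proof (rule the_equality)
  obtain r' where r': "r' \<in> carrier W" "act r' = form_reflection B v"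
    using reflection_ex[OF assms(1)] by blast
  then have "r = r'" using assms by (intro act_eq_imp_eq) auto
  then show "r \<in> carrier W \<and> (\<forall>x\<in>coxeter_space S. act r x = form_reflection B v x)"
    using r' by simp
next
  fix q assume q: "q \<in> carrier W \<and> (\<forall>x\<in>coxeter_space S. act q x = form_reflection B v x)"
  have "act q (basis_root s) = act r (basis_root s)" if s: "s \<in> S" for s
    using conjunct2[OF q, THEN bspec, OF basis_coxeter_space[OF s]] assms(3)[OF s] by metis
  then show "q = r"
    using act_eq_imp_eq q assms(2) by blast
qed

lemma
  assumes "v \<in> \<Delta>"
  shows refl_closed: "refl_of v \<in> carrier W"
    and act_refl: "act (refl_of v) = form_reflection B v"
    and odd_len_refl: "odd (len (refl_of v))"
proof -
  obtain r where r: "r \<in> carrier W" "act r = form_reflection B v" "odd (len r)"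
    using reflection_ex[OF assms(1)] by blast
  then have "refl_of v = r" using assms by (intro reflection_unique) auto
  then show "refl_of v \<in> carrier W" "act (refl_of v) = form_reflection B v" "odd (len (refl_of v))"
    using r by auto
qed

lemma refl_square:
  assumes "v \<in> \<Delta>"
  shows "refl_of v \<otimes> refl_of v = \<one>"
proof (rule act_eq_imp_eq)
  show "act (refl_of v \<otimes> refl_of v) (basis_root s) = act \<one> (basis_root s)" for s
    using refl_closed[OF assms] root_norm[OF assms]
    by (simp add: act_mult act_refl[OF assms] act_one form.form_reflection_involution)
qed (simp_all add: refl_closed[OF assms])

lemma mult_refl_refl:
  assumes "v \<in> \<Delta>" "w \<in> carrier W"
  shows "w \<otimes> refl_of v \<otimes> refl_of v = w"
  using assms refl_closed[of v] refl_square[of v] by (simp add: m_assoc)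

lemma refl_scaled:
  assumes "v \<in> \<Delta>" "k *\<^sub>R v \<in> \<Delta>" "k \<noteq> 0"
  shows "refl_of (k *\<^sub>R v) = refl_of v"
  using assms
  by (intro reflection_unique) (simp_all add: refl_closed act_refl[OF assms(1)] form.form_reflection_scaled)

lemma refl_uminus: "v \<in> \<Delta> \<Longrightarrow> refl_of (- v) = refl_of v"
  using refl_scaled[of v "-1"] uminus_root[of v] by simp

lemma refl_conj:
  assumes "v \<in> \<Delta>" "w \<in> carrier W"
  shows "w \<otimes> refl_of v \<otimes> inv w = refl_of (act w v)"
proof (rule reflection_unique[symmetric])
  show "act (w \<otimes> refl_of v \<otimes> inv w) (basis_root s) = form_reflection B (act w v) (basis_root s)" for s
    using assms act_form_reflection[of w v "act (inv w) (basis_root s)"]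
    by (simp add: act_mult refl_closed act_refl act_act_inv)
qed (use assms act_root refl_closed in auto)

text \<open>A simple reflection changes only the coordinate at \<open>s\<close>. A positive
  coordinate elsewhere would survive in \<open>act s v\<close> and, since roots have coordinates of
  one sign, make it positive.\<close>

lemma basis_nonneg_root_cases:
  assumes v: "v \<in> \<Delta>" "nonneg v" and s: "s \<in> S" and neg: "\<not> nonneg (act s v)"
  shows "\<exists>k. k \<noteq> 0 \<and> v = k *\<^sub>R basis_root s"
proof -
  have "Poly_Mapping.lookup v t = 0" if t: "t \<in> S" "t \<noteq> s" for t
  proof (rule ccontr)
    assume "Poly_Mapping.lookup v t \<noteq> 0"
    then have "0 < Poly_Mapping.lookup v t" using v t by (force simp: nonneg_def)
    also have "Poly_Mapping.lookup v t = Poly_Mapping.lookup (act s v) t"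
      using s t(2) by (simp add: act_S form_reflection_def lookup_minus lookup_scaleR
          basis_root_def lookup_single)
    finally have "\<not> nonneg (- act s v)" using t by (force simp: nonneg_def)
    then show False
      using neg root_cases act_root v s S_carrier by blast
  qed
  then have "v = Poly_Mapping.lookup v s *\<^sub>R basis_root s"
    using root_coxeter_space[OF v(1)]
    by (intro poly_mapping_eqI)
      (auto simp: lookup_scaleR basis_root_def lookup_single when_def coxeter_space_def in_keys_iff)
  moreover have "v \<noteq> 0" using root_norm[OF v(1)] by (auto simp: coxeter_form_def)
  ultimately show ?thesis by (metis scaleR_zero_left)
qed

text \<open>Induction along a left descent \<open>w = s w'\<close>, which inherits the ascent. If
  \<open>w'(v)\<close> is positive and \<open>s w'(v)\<close> is not, then \<open>w'(v)\<close> is a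
  multiple of \<open>\<alpha>_s\<close>, so \<open>w'\<close> conjugates the reflection in
  \<open>v\<close> to \<open>s\<close>. This gives \<open>w s_v = w'\<close>, shorter than
  \<open>w\<close>.\<close>

lemma nonneg_act_if_len_less:
  assumes v: "v \<in> \<Delta>" "nonneg v"
    and w: "w \<in> carrier W" "len w < len (w \<otimes> refl_of v)"
  shows "nonneg (act w v)"
  using w
proof (induction "len w" arbitrary: w rule: less_induct)
  case less
  note w = less.prems(1) and up = less.prems(2)
  let ?r = "refl_of v"
  have r: "?r \<in> carrier W" using v refl_closed by simp
  show ?case
  proof (cases "w = \<one>")
    case True
    then show ?thesis using v by (simp add: act_one)
  next
    case False
    then obtain s where s: "s \<in> S" "len w = len (s \<otimes> w) + 1"
      using exists_left_descent w by blast
    define w' where "w' = s \<otimes> w"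
    have w': "w' \<in> carrier W" "s \<otimes> w' = w"
      using w s by (auto simp: w'_def S_carrier S_mult_S)
    have "len (w \<otimes> ?r) \<le> len s + len (w' \<otimes> ?r)"
      using len_mult_le[of s "w' \<otimes> ?r"] w' s r by (simp add: S_carrier m_assoc[symmetric])
    then have "len w' < len (w' \<otimes> ?r)"
      using up s len_S_le[OF s(1)] by (simp add: w'_def)
    then have pos: "nonneg (act w' v)"
      using less.hyps[of w'] w' s by (simp add: w'_def)
    have w_eq: "act w v = act s (act w' v)"
      using w' s act_mult[of s w'] S_carrier by simp
    show ?thesis
    proof (rule ccontr)
      assume "\<not> nonneg (act w v)"
      then obtain k where k: "k \<noteq> 0" "act w' v = k *\<^sub>R basis_root s"
        using basis_nonneg_root_cases[of "act w' v" s] pos s(1) act_root v(1) w' w_eq by metis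
      have "refl_of (act w' v) = s"
        using act_root[OF v(1) w'(1)] s k
        by (intro reflection_unique) (simp_all add: S_carrier act_S form.form_reflection_scaled)
      then have "w' \<otimes> ?r \<otimes> inv w' = s"
        using refl_conj v w' by simp
      then have "w' \<otimes> ?r = s \<otimes> w'"
        using w' r s S_carrier by (metis inv_solve_right m_closed)
      then have "w \<otimes> ?r = w'"
        using w' mult_refl_refl[OF v(1) w'(1)] by simp
      then show False using up s by (simp add: w'_def)
    qed
  qed
qed

text \<open>For the converse, \<open>w s_v\<close> sends \<open>v\<close> to \<open>- w(v)\<close>.
  If the reflection did not raise the length of \<open>w\<close>, parity would make it raise that of
  \<open>w s_v\<close>, and the forward direction would make \<open>- w(v)\<close>
  nonnegative.\<close>

lemma len_less_refl_iff:
  assumes v: "v \<in> \<Delta>" "nonneg v" and w: "w \<in> carrier W"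
  shows "len w < len (w \<otimes> refl_of v) \<longleftrightarrow> nonneg (act w v)"
proof
  show "nonneg (act w v)" if "len w < len (w \<otimes> refl_of v)"
    using nonneg_act_if_len_less assms that by blast
  show "len w < len (w \<otimes> refl_of v)" if "nonneg (act w v)"
  proof (rule ccontr)
    let ?r = "refl_of v"
    have r: "?r \<in> carrier W" using v refl_closed by simp
    assume "\<not> len w < len (w \<otimes> ?r)"
    moreover have "len w \<noteq> len (w \<otimes> ?r)"
      using even_len_mult[OF w r] odd_len_refl[OF v(1)] by auto
    ultimately have "len (w \<otimes> ?r) < len (w \<otimes> ?r \<otimes> ?r)"
      using mult_refl_refl[OF v(1) w] by simp
    then have "nonneg (act (w \<otimes> ?r) v)"
      using nonneg_act_if_len_less v w r by simp
    moreover have "act (w \<otimes> ?r) v = - act w v"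
      using v w r root_norm[OF v(1)]
      by (simp add: act_mult act_refl form_reflection_def act_minus scaleR_2)
    ultimately show False
      using that nonneg_uminus_root act_root v w by metis
  qed
qed

end

section \<open>Dihedral sequences\<close>

text \<open>Reverses the orientation of the plane, so that a sequence running clockwise can be
  described with increasing angles.\<close>

lemma (in orthonormal_pair) orthonormal_pair_flip:
  assumes "d = 1 \<or> d = -1"
  shows "orthonormal_pair B e1 (d *\<^sub>R e2)" "orthonormal_pair.E e1 (d *\<^sub>R e2) (d * t) = E t"
proof -
  show o: "orthonormal_pair B e1 (d *\<^sub>R e2)"
    using assms by unfold_locales (auto simp: B_simps)
  show "orthonormal_pair.E e1 (d *\<^sub>R e2) (d * t) = E t"
    using assms by (auto simp: orthonormal_pair.E_def[OF o] E_def)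
qed

lemma sin_int_multiple_eq_0:
  assumes "0 < m"
  shows "sin (of_int n * (pi / real m)) = 0 \<longleftrightarrow> int m dvd n"
proof -
  have "sin (of_int n * (pi / real m)) = 0 \<longleftrightarrow> (\<exists>i::int. of_int n * (pi / real m) = of_int i * pi)"
    by (simp add: sin_zero_iff_int2)
  also have "\<dots> \<longleftrightarrow> (\<exists>i::int. real_of_int n = real_of_int (int m * i))"
    using assms by (simp add: field_simps)
  also have "\<dots> \<longleftrightarrow> int m dvd n"
    unfolding of_int_eq_iff dvd_def ..
  finally show ?thesis .
qed

lemma sin_int_multiple_pos:
  assumes "0 < n" "n < int m"
  shows "0 < sin (of_int n * (pi / real m))"
proof (rule sin_gt_zero)
  show "0 < of_int n * (pi / real m)" using assms by simp
  have "real_of_int n < real m" using assms(2) by linarith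
  then show "of_int n * (pi / real m) < pi" using assms by (simp add: field_simps)
qed

context normalized_coxeter_system
begin

lemma dihedral_sequence_root:
  assumes "dihedral_sequence W S c m g"
  shows "g i \<in> \<Delta>"
proof (induction i rule: less_induct)
  case (less i)
  have m: "2 \<le> m" "\<And>i. i < m \<Longrightarrow> g i \<in> \<Delta>p" "\<And>j. g (j + m) = - g j"
    using assms by (auto simp: dihedral_sequence_def)
  show ?case
  proof (cases "i < m")
    case True
    then show ?thesis using m pos_root_iff by blast
  next
    case False
    then have "g i = - g (i - m)" using m(3)[of "i - m"] by simp
    then show ?thesis using less[of "i - m"] False m(1) uminus_root by simp
  qed
qed

text \<open>The directions of the roots in the plane are the multiples of \<open>\<pi>/m\<close>. As the cone over two
  neighbours contains no other root, neighbours are one step apart, and as no direction is repeated,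
  all steps go the same way.\<close>

lemma dihedral_sequence_angles:
  assumes g: "dihedral_sequence W S c m g"
  shows "\<exists>e1 e2 b r. orthonormal_pair B e1 e2 \<and> (\<forall>i. 0 < r i) \<and>
    (\<forall>i. g i = r i *\<^sub>R orthonormal_pair.E e1 e2 (b + real i * (pi / real m)))"
proof -
  define R where "R = g ` {..<m} \<union> (\<lambda>i. - g i) ` {..<m}"
  define p where "p = pi / real m"
  have m2: "2 \<le> m" and g_pos: "\<And>i. i < m \<Longrightarrow> g i \<in> \<Delta>p"
    and g_add: "\<And>j. g (j + m) = - g j" and I2: "root_system_I2 B m R"
    and cone: "\<And>i. i + 1 < m \<Longrightarrow>
        {a *\<^sub>R g i + b *\<^sub>R g (i + 1) | a b. 0 \<le> a \<and> 0 \<le> b} \<inter> \<Delta>p = {g i, g (i + 1)}"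
    using g by (auto simp: dihedral_sequence_def R_def)
  have m0: "0 < m" using m2 by simp
  have mp: "real m * p = pi" using m2 by (simp add: p_def)
  have sin_p: "0 < sin p" using sin_int_multiple_pos[of 1 m] m2 by (simp add: p_def)
  have R_root: "x \<in> \<Delta>" if "x \<in> R" for x
    using that g_pos uminus_root by (auto simp: R_def pos_root_iff)
  have R_minus: "- x \<in> R" if "x \<in> R" for x
    using that by (force simp: R_def)
  have R_refl: "form_reflection B x y \<in> R" if "x \<in> R" "y \<in> R" for x y
    using I2 that by (auto simp: root_system_I2_def)
  obtain u v where uv: "u \<in> R" "v \<in> R" "B u v = - cos p * sqrt (B u u) * sqrt (B v v)"
    using I2 by (auto simp: root_system_I2_def p_def)
  have uu: "0 < B u u" "0 < B v v" using uv R_root root_norm by auto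
  \<comment> \<open>The two simple roots of the dihedral system, scaled to unit length, fix the
    angles 0 and \<open>pi - p\<close>.\<close>
  define a b where "a = (1 / sqrt (B u u)) *\<^sub>R u" and "b = (1 / sqrt (B v v)) *\<^sub>R v"
  have "B a a = 1" "B b b = 1" "B a b = - cos p"
    using uu uv(3) by (simp_all add: a_def b_def form.bilinear_simps real_sqrt_mult_self
        field_simps flip: power2_eq_square)
  then obtain e2 where o: "orthonormal_pair B a e2"
    and E0: "orthonormal_pair.E a e2 0 = a" and Ep: "orthonormal_pair.E a e2 (pi - p) = b"
    using form.orthonormal_pair_of_angle[of a b p] sin_p by auto
  interpret o: orthonormal_pair B a e2 by (rule o)
  define D where "D j = o.E (of_int j * p)" for j :: int
  have D_shift: "D (j + int m * q) = (if even q then 1 else -1) *\<^sub>R D j" for j q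
  proof -
    have "of_int (j + int m * q) * p = of_int j * p + of_int q * pi"
      by (simp add: mp[symmetric] algebra_simps)
    then show ?thesis by (simp only: D_def o.E_add_int_pi)
  qed
  have D_parallel: "int m dvd j - l" if "s *\<^sub>R D j = t *\<^sub>R D l" "s \<noteq> 0" for s t j l
  proof -
    have "sin (of_int j * p - of_int l * p) = 0"
      using that unfolding D_def by (rule o.E_parallel)
    then show ?thesis
      using sin_int_multiple_eq_0[of m "j - l"] m2 by (simp add: p_def left_diff_distrib diff_divide_distrib)
  qed
  \<comment> \<open>The direction \<open>j\<close> carries a root. Reflection followed by negation
    sends direction \<open>l\<close> to \<open>2 * j - l\<close>, so the two adjacent directions 0
    and 1, obtained from the simple roots, yield all directions.\<close>
  define dir where "dir j \<longleftrightarrow> (\<exists>x\<in>R. \<exists>r>0. x = r *\<^sub>R D j)" for j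
  have dir_refl: "dir (2 * j - l)" if j: "dir j" and l: "dir l" for j l
  proof -
    obtain x s where x: "x \<in> R" "0 < s" "x = s *\<^sub>R D j" using j by (auto simp: dir_def)
    obtain y t where y: "y \<in> R" "0 < t" "y = t *\<^sub>R D l" using l by (auto simp: dir_def)
    have "form_reflection B x y = t *\<^sub>R form_reflection B (D j) (D l)"
      using x y by (simp add: form.form_reflection_scaled form.form_reflection_scale)
    also have "\<dots> = - (t *\<^sub>R D (2 * j - l))"
      by (simp add: D_def o.form_reflection_E_E algebra_simps)
    finally have "t *\<^sub>R D (2 * j - l) = - form_reflection B x y" by simp
    then show ?thesis using R_minus[OF R_refl[OF x(1) y(1)]] y(2) by (auto simp: dir_def)
  qed
  have "D 0 = a" using E0 by (simp add: D_def)
  then have "u = sqrt (B u u) *\<^sub>R D 0" using uu by (simp add: a_def)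
  then have dir0: "dir 0"
    unfolding dir_def using uv uu by (metis real_sqrt_gt_zero)
  have "b = D (int m - 1)"
    using Ep mp by (simp add: D_def left_diff_distrib)
  also have "\<dots> = - D (-1)"
    using D_shift[of "-1" 1] by simp
  finally have bD: "b = - D (-1)" .
  have "v = sqrt (B v v) *\<^sub>R b" using uu by (simp add: b_def)
  then have "- v = sqrt (B v v) *\<^sub>R D (-1)"
    unfolding bD by (metis minus_minus scaleR_minus_right)
  then have "dir (-1)"
    unfolding dir_def using R_minus[OF uv(2)] uu by (metis real_sqrt_gt_zero)
  then have dir1: "dir 1" using dir_refl[OF dir0, of "-1"] by simp
  have "dir j \<and> dir (j + 1)" for j
  proof (induction j rule: int_induct[of _ 0])
    case base
    then show ?case using dir0 dir1 by simp
  next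
    case (step1 i)
    then show ?case using dir_refl[of "i + 1" i] by (simp add: algebra_simps)
  next
    case (step2 i)
    then show ?case using dir_refl[of i "i + 1"] by (simp add: algebra_simps)
  qed
  then have dir: "dir j" for j by blast
  have "\<exists>i<m. \<exists>s. s \<noteq> 0 \<and> g i = s *\<^sub>R D j" for j
  proof -
    obtain x t where x: "x \<in> R" "0 < t" "x = t *\<^sub>R D j" using dir[of j] by (auto simp: dir_def)
    then obtain i where i: "i < m" "g i = x \<or> g i = - x" by (auto simp: R_def)
    then show ?thesis
      using x(2,3) by (metis less_irrefl neg_equal_0_iff_equal scaleR_minus_left)
  qed
  then obtain f s where f: "\<And>j. f j < m" "\<And>j. s j \<noteq> 0" "\<And>j. g (f j) = s j *\<^sub>R D j"
    by metis
  \<comment> \<open>Pigeonhole: \<open>m\<close> pairwise nonparallel lines each contain some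
    \<open>g i\<close>, and there are only \<open>m\<close> indices, so every \<open>g i\<close>
    lies on one of these lines.\<close>
  have "inj_on (\<lambda>j. f (int j)) {..<m}"
  proof (rule inj_onI)
    fix j l assume jl: "j \<in> {..<m}" "l \<in> {..<m}" "f (int j) = f (int l)"
    then have "s (int j) *\<^sub>R D (int j) = s (int l) *\<^sub>R D (int l)" using f(3) by metis
    then have "int m dvd int j - int l" using D_parallel f(2) by blast
    then show "j = l" using jl zdvd_imp_le[of "int m" "int j - int l"]
        zdvd_imp_le[of "int m" "int l - int j"] dvd_diff_commute[of "int m"] by fastforce
  qed
  then have "(\<lambda>j. f (int j)) ` {..<m} = {..<m}"
    by (intro endo_inj_surj) (auto simp: f(1))
  then have "\<exists>j<m. f (int j) = i" if "i < m" for i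
    using that by (metis imageE lessThan_iff)
  then obtain J where J: "\<And>i. i < m \<Longrightarrow> J i < m" "\<And>i. i < m \<Longrightarrow> f (int (J i)) = i"
    by metis
  \<comment> \<open>A shift by \<open>m\<close> is a half turn and absorbs a negative coefficient.
    Thus \<open>g i\<close> is a positive multiple of \<open>D (n i)\<close>, where
    \<open>n i\<close> matters only modulo \<open>2 * m\<close>.\<close>
  define n where "n i = (if 0 < s (int (J i)) then int (J i) else int (J i) + int m)" for i
  have g_n: "g i = \<bar>s (int (J i))\<bar> *\<^sub>R D (n i)" if "i < m" for i
    using f(3)[of "int (J i)"] J(2)[OF that] D_shift[of "int (J i)" 1] by (auto simp: n_def)
  have n_inj: "i = l" if il: "i < m" "l < m" and dvd: "int m dvd n i - n l" for i l
  proof -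
    have 1: "int m dvd n i - int (J i)" and 2: "int m dvd n l - int (J l)" by (auto simp: n_def)
    have "int m dvd (n i - n l) - (n i - int (J i)) + (n l - int (J l))"
      by (rule dvd_add[OF dvd_diff[OF dvd 1] 2])
    then have "int m dvd int (J i) - int (J l)" by simp
    then have "J i = J l" using J(1)[OF il(1)] J(1)[OF il(2)]
        zdvd_imp_le[of "int m" "int (J i) - int (J l)"]
        zdvd_imp_le[of "int m" "int (J l) - int (J i)"] dvd_diff_commute[of "int m"] by fastforce
    then show ?thesis using J(2) il by metis
  qed
  \<comment> \<open>A root in a direction \<open>q\<close> strictly inside the cone over two
    neighbours is a positive root there, hence one of the neighbours, which the nonzero sines
    exclude. The conditions are on quotients of sines so that one argument serves both senses of
    rotation.\<close>
  have between: False
    if i: "i + 1 < m" and gi: "g i = s1 *\<^sub>R D j" "g (i + 1) = s2 *\<^sub>R D l" "0 < s1" "0 < s2"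
      and sgn: "0 < sin (of_int (l - q) * p) / sin (of_int (l - j) * p)"
        "0 < sin (of_int (q - j) * p) / sin (of_int (l - j) * p)"
    for i j l q s1 s2
  proof -
    obtain x t where x: "x \<in> R" "0 < t" "x = t *\<^sub>R D q" using dir[of q] by (auto simp: dir_def)
    let ?sl = "sin (of_int (l - j) * p)"
    let ?a = "t * (sin (of_int (l - q) * p) / ?sl) / s1"
    let ?b = "t * (sin (of_int (q - j) * p) / ?sl) / s2"
    have "?sl *\<^sub>R D q = sin (of_int (l - q) * p) *\<^sub>R D j + sin (of_int (q - j) * p) *\<^sub>R D l"
      using o.E_interpolate[of "of_int l * p" "of_int j * p" "of_int q * p"]
      by (simp add: D_def left_diff_distrib)
    then have "(1 / ?sl) *\<^sub>R ?sl *\<^sub>R D q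
        = (1 / ?sl) *\<^sub>R (sin (of_int (l - q) * p) *\<^sub>R D j + sin (of_int (q - j) * p) *\<^sub>R D l)"
      by simp
    moreover have "?sl \<noteq> 0" using sgn by auto
    ultimately have "D q = (sin (of_int (l - q) * p) / ?sl) *\<^sub>R D j
        + (sin (of_int (q - j) * p) / ?sl) *\<^sub>R D l"
      by (simp add: scaleR_add_right)
    then have x_eq: "x = ?a *\<^sub>R g i + ?b *\<^sub>R g (i + 1)"
      unfolding gi x(3) using gi(3,4) by (simp add: scaleR_add_right)
    have ab: "0 < ?a" "0 < ?b"
      using divide_pos_pos[OF mult_pos_pos[OF x(2) sgn(1)] gi(3)]
        divide_pos_pos[OF mult_pos_pos[OF x(2) sgn(2)] gi(4)] .
    have "nonneg x"
      unfolding x_eq using ab g_pos[of i] g_pos[of "i + 1"] i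
      by (intro nonneg_add nonneg_scale) (auto simp: pos_root_iff)
    then have "x \<in> \<Delta>p" using R_root[OF x(1)] pos_root_iff by blast
    moreover have "x \<in> {a *\<^sub>R g i + b *\<^sub>R g (i + 1) | a b. 0 \<le> a \<and> 0 \<le> b}"
      using x_eq ab less_imp_le by blast
    ultimately have "x \<in> {g i, g (i + 1)}" using cone[OF i] by blast
    then have "int m dvd q - j \<or> int m dvd q - l"
      using D_parallel x(2,3) gi by (metis insertE less_irrefl singletonD)
    then have "sin (of_int (q - j) * p) = 0 \<or> sin (of_int (l - q) * p) = 0"
      unfolding p_def sin_int_multiple_eq_0[OF m0] using dvd_diff_commute[of "int m" l q] by blast
    then show False using sgn by auto
  qed
  have step: "\<exists>d. (d = 1 \<or> d = -1) \<and> 2 * int m dvd n (i + 1) - n i - d" if i: "i + 1 < m" for i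
  proof -
    define D0 where "D0 = (n (i + 1) - n i) mod (2 * int m)"
    \<comment> \<open>The residue of \<open>n (i + 1) - n i\<close> nearest to 0: the signed number
      of steps along the shorter way around. If it were not 1 or -1, the direction next to
      \<open>n i\<close> on that side would lie strictly inside the cone.\<close>
    define e where "e = (if D0 < int m then D0 else D0 - 2 * int m)"
    have D0: "0 \<le> D0" "D0 < 2 * int m" using m2 by (simp_all add: D0_def)
    have "2 * int m dvd n (i + 1) - n i - D0" by (simp add: D0_def mod_eq_dvd_iff[symmetric])
    then have "2 * int m dvd n (i + 1) - n i - D0 + 2 * int m" by (intro dvd_add) auto
    with \<open>2 * int m dvd n (i + 1) - n i - D0\<close> have e: "2 * int m dvd n (i + 1) - n i - e"
      by (simp add: e_def algebra_simps)
    have "\<not> int m dvd n (i + 1) - n i" using n_inj[of "i + 1" i] i by auto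
    moreover have "int m dvd n (i + 1) - n i - e" using e dvd_mult_right by blast
    ultimately have ne: "\<not> int m dvd e" by (metis diff_add_cancel dvd_add)
    have e_bound: "- int m < e" "e < int m" "e \<noteq> 0"
      using D0 ne by (auto simp: e_def split: if_splits) (smt (verit) dvd_minus_iff dvd_refl)
    obtain q where q: "n (i + 1) - n i - e = 2 * int m * q" using e by blast
    then have "n (i + 1) = n i + e + int m * (2 * q)" by simp
    then have "D (n (i + 1)) = D (n i + e)" by (simp only: D_shift) simp
    then have gs: "g i = \<bar>s (int (J i))\<bar> *\<^sub>R D (n i)"
        "g (i + 1) = \<bar>s (int (J (i + 1)))\<bar> *\<^sub>R D (n i + e)"
        "0 < \<bar>s (int (J i))\<bar>" "0 < \<bar>s (int (J (i + 1)))\<bar>"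
      using g_n[of i] g_n[of "i + 1"] i f(2) by simp_all
    have sin_pos: "0 < sin (of_int k * p)" if "0 < k" "k < int m" for k
      using sin_int_multiple_pos that unfolding p_def by blast
    have sin_neg: "sin (of_int k * p) < 0" if "k < 0" "- int m < k" for k
      using sin_pos[of "- k"] that by simp
    have "e = 1 \<or> e = -1"
    proof (rule ccontr)
      assume ne: "\<not> (e = 1 \<or> e = -1)"
      show False
      proof (cases "0 < e")
        case True
        show False
          by (rule between[OF i gs, of "n i + 1"])
            (use True ne e_bound sin_pos[of "e - 1"] sin_pos[of e] sin_pos[of 1] m2 in simp_all)
      next
        case False
        show False
          by (rule between[OF i gs, of "n i - 1"])
            (use False ne e_bound sin_neg[of "e + 1"] sin_neg[of e] sin_neg[of "-1"] m2
              in \<open>simp_all add: divide_neg_neg divide_pos_neg\<close>)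
      qed
    qed
    then show ?thesis using e by blast
  qed
  then obtain d where d: "\<And>i. i + 1 < m \<Longrightarrow> d i = 1 \<or> d i = (-1::int)"
    "\<And>i. i + 1 < m \<Longrightarrow> 2 * int m dvd n (i + 1) - n i - d i"
    by metis
  \<comment> \<open>A change of sense would bring \<open>g (i + 2)\<close> back to the direction of
    \<open>g i\<close>, against \<open>n_inj\<close>.\<close>
  have d_Suc: "d (i + 1) = d i" if i: "i + 2 < m" for i
  proof (rule ccontr)
    assume "d (i + 1) \<noteq> d i"
    then have "d (i + 1) = - d i" using d(1)[of i] d(1)[of "i + 1"] i by auto
    then have "(n (i + 1 + 1) - n (i + 1) - d (i + 1)) + (n (i + 1) - n i - d i) = n (i + 2) - n i"
      by simp
    moreover have "2 * int m dvd (n (i + 1 + 1) - n (i + 1) - d (i + 1)) + (n (i + 1) - n i - d i)"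
      using d(2)[of i] d(2)[of "i + 1"] i by (intro dvd_add) auto
    ultimately have "2 * int m dvd n (i + 2) - n i" by metis
    then have "int m dvd n (i + 2) - n i" using dvd_mult_right by blast
    then show False using n_inj[of "i + 2" i] i by simp
  qed
  have d_const: "d i = d 0" if "i + 1 < m" for i
    using that by (induction i) (use d_Suc in auto)
  define d0 where "d0 = d 0"
  have d0: "d0 = 1 \<or> d0 = -1" using d(1)[of 0] m2 by (simp add: d0_def)
  have n_eq: "2 * int m dvd n i - (n 0 + d0 * int i)" if "i < m" for i
    using that
  proof (induction i)
    case (Suc i)
    then have "2 * int m dvd (n i - (n 0 + d0 * int i)) + (n (i + 1) - n i - d0)"
      using d(2)[of i] d_const[of i] by (intro dvd_add) (auto simp: d0_def)
    then show ?case by (simp add: algebra_simps)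
  qed simp
  have "\<exists>t>0. g i = t *\<^sub>R D (n 0 + d0 * int i)" for i
  proof (induction i rule: less_induct)
    case (less i)
    show ?case
    proof (cases "i < m")
      case True
      obtain q where "n i - (n 0 + d0 * int i) = 2 * int m * q" using n_eq[OF True] by blast
      then have "n i = n 0 + d0 * int i + int m * (2 * q)" by simp
      then have "D (n i) = D (n 0 + d0 * int i)" by (simp only: D_shift) simp
      then show ?thesis using g_n[OF True] f(2) by (metis zero_less_abs_iff)
    next
      case False
      then obtain t where t: "0 < t" "g (i - m) = t *\<^sub>R D (n 0 + d0 * int (i - m))"
        using less[of "i - m"] m2 by auto
      have i: "n 0 + d0 * int i = n 0 + d0 * int (i - m) + int m * d0"
        using False by (simp add: of_nat_diff right_diff_distrib)
      \<comment> \<open>Moving \<open>m\<close> steps in either sense is a half turn, because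
        \<open>d0\<close> is odd; this matches \<open>g (j + m) = - g j\<close>.\<close>
      have "D (n 0 + d0 * int i) = - D (n 0 + d0 * int (i - m))"
        unfolding i D_shift using d0 by (elim disjE) simp_all
      then show ?thesis
        using t g_add[of "i - m"] False by (intro exI[of _ t]) simp
    qed
  qed
  then obtain r where r: "\<And>i. 0 < r i" "\<And>i. g i = r i *\<^sub>R D (n 0 + d0 * int i)"
    by metis
  let ?d = "real_of_int d0"
  have dd: "?d = 1 \<or> ?d = -1" using d0 by auto
  show ?thesis
  proof (intro exI conjI allI)
    show "orthonormal_pair B a (?d *\<^sub>R e2)" by (rule o.orthonormal_pair_flip(1)[OF dd])
    fix i
    have "?d * (of_int (n 0) * p) + real i * (pi / real m) = ?d * (of_int (n 0 + d0 * int i) * p)"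
      using d0 by (auto simp: p_def algebra_simps)
    then show "g i = r i *\<^sub>R orthonormal_pair.E a (?d *\<^sub>R e2)
        (?d * (of_int (n 0) * p) + real i * (pi / real m))"
      using r(2)[of i] o.orthonormal_pair_flip(2)[OF dd] by (simp add: D_def)
  qed (rule r(1))
qed

end

text \<open>Both counts are the length of the same interval of indices: \<open>f\<close> is true on an initial or on a
  final segment of \<open>{..<m}\<close>.\<close>

lemma antiperiodic_count:
  fixes f :: "nat \<Rightarrow> bool"
  assumes anti: "\<And>j. f (j + m) \<longleftrightarrow> \<not> f j"
    and convex: "\<And>i l j. \<lbrakk>i \<le> l; l \<le> j; j < i + m; f i; f j\<rbrakk> \<Longrightarrow> f l"
    and k: "1 \<le> k" "2 * k \<le> m"
  shows "card {i. i + k < m \<and> f (i + k) \<and> \<not> f (i + 2 * k)}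
       = card {i. i < m \<and> m \<le> i + k \<and> \<not> f (i + k) \<and> \<not> f (i + 2 * k)}"
proof -
  \<comment> \<open>Shifting by \<open>m\<close> exchanges \<open>f\<close> and its negation, so the
    complement is convex as well.\<close>
  have convex': "\<not> f l" if "i \<le> l" "l \<le> j" "j < i + m" "\<not> f i" "\<not> f j" for i l j
    using convex[of "i + m" "l + m" "j + m"] that by (auto simp: anti)
  have anti': "f j \<longleftrightarrow> \<not> f (j - m)" if "m \<le> j" for j
    using anti[of "j - m"] that by simp
  have m: "0 < m" using k by simp
  \<comment> \<open>The first change of value. By convexity there is no second change before
    \<open>m\<close>, and antiperiodicity places the next one at \<open>m + q\<close>.\<close>
  define q where "q = (LEAST j. f j \<noteq> f 0)"
  have ex: "f m \<noteq> f 0" using anti[of 0] by simp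
  then have q: "f q \<noteq> f 0" unfolding q_def by (rule LeastI)
  have qm: "q \<le> m" unfolding q_def using ex by (rule Least_le)
  have q0: "0 < q" using q by (cases q) auto
  have below: "f j = f 0" if "j < q" for j
    using not_less_Least[of j "\<lambda>j. f j \<noteq> f 0"] that by (simp add: q_def)
  have above: "f j \<noteq> f 0" if "q \<le> j" "j < m" for j
    using convex[of q j m] convex'[of q j m] that q ex q0 by (cases "f 0") auto
  \<comment> \<open>Two periods suffice: every index below, including \<open>i + 2 * k\<close>,
    stays under \<open>2 * m\<close> because \<open>2 * k \<le> m\<close>.\<close>
  have f: "f j \<longleftrightarrow> (if j < q then f 0 else if j < m + q then \<not> f 0 else f 0)" if "j < 2 * m" for j
  proof (cases "j < m")
    case True
    then show ?thesis using below[of j] above[of j] by auto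
  next
    case False
    then have jm: "m \<le> j" "j - m < m" using that by simp_all
    have "f (j - m) \<longleftrightarrow> (if j - m < q then f 0 else \<not> f 0)"
      using below[of "j - m"] above[of "j - m"] jm(2) by auto
    then show ?thesis
      unfolding anti'[OF jm(1)] using jm qm by auto
  qed
  show ?thesis
  proof (cases "f 0")
    case True
    have f': "f j \<longleftrightarrow> j < q \<or> m + q \<le> j" if "j < 2 * m" for j
      using f[OF that] True qm by auto
    \<comment> \<open>The truncated subtraction at the lower end here corresponds to the
      \<open>min\<close> at the upper end of the second interval: both have \<open>k\<close>,
      \<open>q - k\<close> or 0 elements, according to where \<open>q\<close> lies relative to
      \<open>k\<close> and \<open>2 * k\<close>.\<close>
    have "{i. i + k < m \<and> f (i + k) \<and> \<not> f (i + 2 * k)} = {q - 2 * k..<q - k}"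
      using k qm by (auto simp: f'; arith)
    moreover have "{i. i < m \<and> m \<le> i + k \<and> \<not> f (i + k) \<and> \<not> f (i + 2 * k)}
        = {m - k..<min m (m + q - 2 * k)}"
      using k qm by (auto simp: f'; arith)
    ultimately show ?thesis using k qm by simp
  next
    case False
    have f': "f j \<longleftrightarrow> q \<le> j \<and> j < m + q" if "j < 2 * m" for j
      using f[OF that] False qm by auto
    have "{i. i + k < m \<and> f (i + k) \<and> \<not> f (i + 2 * k)} = {m + q - 2 * k..<m - k}"
      using k qm by (auto simp: f'; arith)
    moreover have "{i. i < m \<and> m \<le> i + k \<and> \<not> f (i + k) \<and> \<not> f (i + 2 * k)}
        = {m + q - k..<m}"
      using k qm by (auto simp: f'; arith)
    ultimately show ?thesis using k qm by simp
  qed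
qed

section \<open>Reflections and signs along a dihedral sequence\<close>

context normalized_coxeter_system
begin

lemma nonneg_act_uminus:
  "v \<in> \<Delta> \<Longrightarrow> w \<in> carrier W \<Longrightarrow> nonneg (act w (- v)) \<longleftrightarrow> \<not> nonneg (act w v)"
  by (simp add: act_minus nonneg_uminus_root act_root)

lemma nonneg_act_scale_iff:
  "0 < r \<Longrightarrow> w \<in> carrier W \<Longrightarrow> nonneg (act w (r *\<^sub>R v)) \<longleftrightarrow> nonneg (act w v)"
  by (simp add: act_scale nonneg_scale_iff)

context
  fixes m g
  assumes g: "dihedral_sequence W S c m g"
begin

lemma g_root: "g i \<in> \<Delta>"
  using g by (rule dihedral_sequence_root)

lemma g_shift: "g (j + m) = - g j"
  using g by (simp add: dihedral_sequence_def)

text \<open>Both sides act as the rotation by twice the same angle, and \<open>W\<close> acts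
  faithfully. The condition \<open>j - i = j' - i'\<close> is written additively because the indices
  are natural numbers.\<close>

lemma refl_g_rotate:
  assumes "j + i' = j' + i"
  shows "refl_of (g j) \<otimes> refl_of (g i) = refl_of (g j') \<otimes> refl_of (g i')"
proof -
  obtain e1 e2 r b where o: "orthonormal_pair B e1 e2" and r: "\<And>i. 0 < r i"
    and gE: "\<And>i. g i = r i *\<^sub>R orthonormal_pair.E e1 e2 (b + real i * (pi / real m))"
    using dihedral_sequence_angles[OF g] by auto
  interpret o: orthonormal_pair B e1 e2 by (rule o)
  have refl: "form_reflection B (g i) = form_reflection B (o.E (b + real i * (pi / real m)))" for i
    using r[of i] unfolding gE by (intro form.form_reflection_scaled) simp
  have "real j - real i = real j' - real i'" using assms by linarith
  then have "(real j - real i) * (pi / real m) = (real j' - real i') * (pi / real m)" by simp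
  then have "b + real j * (pi / real m) - (b + real i * (pi / real m))
      = b + real j' * (pi / real m) - (b + real i' * (pi / real m))"
    by (simp only: left_diff_distrib)
  then have "form_reflection B (g j) (form_reflection B (g i) x)
      = form_reflection B (g j') (form_reflection B (g i') x)" for x
    unfolding refl by (rule o.form_reflection_E_rotate)
  then show ?thesis
    by (intro act_eq_imp_eq) (simp_all add: refl_closed g_root act_mult act_refl)
qed

lemma refl_g_shift: "refl_of (g (j + m)) = refl_of (g j)"
  by (simp add: g_shift refl_uminus g_root)

lemma nonneg_act_g_shift:
  "w \<in> carrier W \<Longrightarrow> nonneg (act w (g (j + m))) \<longleftrightarrow> \<not> nonneg (act w (g j))"
  by (simp add: g_shift nonneg_act_uminus g_root)

text \<open>The bound \<open>j < i + m\<close> keeps the angle from \<open>g i\<close> to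
  \<open>g j\<close> below \<open>pi\<close>, so \<open>g l\<close> lies in their cone, and
  \<open>w\<close> acts linearly.\<close>

lemma nonneg_act_g_convex:
  assumes w: "w \<in> carrier W" and "i \<le> l" "l \<le> j" "j < i + m"
    and pos: "nonneg (act w (g i))" "nonneg (act w (g j))"
  shows "nonneg (act w (g l))"
proof (cases "l = i \<or> l = j")
  case False
  obtain e1 e2 r b where o: "orthonormal_pair B e1 e2" and r: "\<And>i. 0 < r i"
    and gE: "\<And>i. g i = r i *\<^sub>R orthonormal_pair.E e1 e2 (b + real i * (pi / real m))"
    using dihedral_sequence_angles[OF g] by auto
  interpret o: orthonormal_pair B e1 e2 by (rule o)
  define D where "D i = o.E (b + real i * (pi / real m))" for i
  have D: "nonneg (act w (D i)) \<longleftrightarrow> nonneg (act w (g i))" for i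
    unfolding gE D_def using r w by (simp add: nonneg_act_scale_iff)
  have sin: "0 < sin (b + real y * (pi / real m) - (b + real x * (pi / real m)))"
    if "x < y" "y < x + m" for x y
  proof -
    have "b + real y * (pi / real m) - (b + real x * (pi / real m)) = of_int (int y - int x) * (pi / real m)"
      by (simp add: left_diff_distrib diff_divide_distrib)
    then show ?thesis using sin_int_multiple_pos[of "int y - int x" m] that by simp
  qed
  have il: "i < l" "l < j" using assms False by auto
  let ?a = "\<lambda>i. b + real i * (pi / real m)"
  have "sin (?a j - ?a i) *\<^sub>R D l = sin (?a j - ?a l) *\<^sub>R D i + sin (?a l - ?a i) *\<^sub>R D j"
    unfolding D_def by (rule o.E_interpolate)
  then have "act w (sin (?a j - ?a i) *\<^sub>R D l)
      = sin (?a j - ?a l) *\<^sub>R act w (D i) + sin (?a l - ?a i) *\<^sub>R act w (D j)"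
    by (simp only: act_add[OF w] act_scale[OF w])
  moreover have "nonneg \<dots>"
    using pos sin[of l j] sin[of i l] il assms(4)
    by (intro nonneg_add nonneg_scale) (simp_all only: D, simp_all)
  ultimately have "nonneg (act w (sin (?a j - ?a i) *\<^sub>R D l))" by metis
  then show ?thesis
    using sin[of i j] il assms(4) w by (simp add: nonneg_act_scale_iff D)
qed (use pos in auto)

text \<open>Direction \<open>i + k\<close> is midway between \<open>i\<close> and
  \<open>i + 2 * k\<close>, so its reflection sends \<open>g i\<close> to a negative multiple of
  \<open>g (i + 2 * k)\<close>. The sign test for the second step of a term thus becomes a test on
  \<open>w\<close> itself.\<close>

lemma nonneg_act_refl_g:
  assumes w: "w \<in> carrier W"
  shows "nonneg (act (w \<otimes> refl_of (g (i + k))) (g i)) \<longleftrightarrow> \<not> nonneg (act w (g (i + 2 * k)))"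
proof -
  obtain e1 e2 r b where o: "orthonormal_pair B e1 e2" and r: "\<And>i. 0 < r i"
    and gE: "\<And>i. g i = r i *\<^sub>R orthonormal_pair.E e1 e2 (b + real i * (pi / real m))"
    using dihedral_sequence_angles[OF g] by auto
  interpret o: orthonormal_pair B e1 e2 by (rule o)
  define D where "D i = o.E (b + real i * (pi / real m))" for i
  have "2 * (b + real (i + k) * (pi / real m)) - (b + real i * (pi / real m))
      = b + real (i + 2 * k) * (pi / real m)"
    by (simp add: algebra_simps add_divide_distrib)
  then have "form_reflection B (D (i + k)) (D i) = - D (i + 2 * k)"
    by (simp only: D_def o.form_reflection_E_E)
  then have refl: "form_reflection B (g (i + k)) (g i) = r i *\<^sub>R (- D (i + 2 * k))"
    using r[of "i + k"] unfolding gE D_def[symmetric]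
    by (simp add: form.form_reflection_scaled form.form_reflection_scale)
  also have "\<dots> = (r i / r (i + 2 * k)) *\<^sub>R (- g (i + 2 * k))"
    using r[of "i + 2 * k"] unfolding gE D_def[symmetric] by simp
  finally have "act (w \<otimes> refl_of (g (i + k))) (g i) = act w ((r i / r (i + 2 * k)) *\<^sub>R (- g (i + 2 * k)))"
    using w by (simp only: act_mult refl_closed g_root act_refl)
  then show ?thesis
    using w r[of i] r[of "i + 2 * k"]
    by (simp only: nonneg_act_scale_iff divide_pos_pos nonneg_act_uminus g_root)
qed

text \<open>Induction on \<open>n\<close>: the two new factors satisfy
  \<open>t_(2n+1) t_(2n+2) = t_n t_(n+1)\<close>, and the earlier product \<open>t_n\<close> cancels
  the first of these. The reversed product is symmetric.\<close>

lemma prod_refl_g: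
  "wp (map (\<lambda>i. refl_of (g i)) [0..<2 * n + 1]) = refl_of (g n)"
  "wp (map (\<lambda>i. refl_of (g i)) (rev [0..<2 * n + 1])) = refl_of (g n)"
proof -
  let ?t = "\<lambda>i. refl_of (g i)"
  have t: "?t i \<in> carrier W" for i using refl_closed g_root by blast
  have t_list: "map ?t xs \<in> lists (carrier W)" for xs using t by auto
  have "wp (map ?t [0..<2 * n + 1]) = ?t n \<and> wp (map ?t (rev [0..<2 * n + 1])) = ?t n"
  proof (induction n)
    case (Suc n)
    have "[0..<2 * Suc n + 1] = [0..<2 * n + 1] @ [2 * n + 1, 2 * n + 2]" by simp
    then have eq: "map ?t [0..<2 * Suc n + 1] = map ?t [0..<2 * n + 1] @ [?t (2 * n + 1), ?t (2 * n + 2)]"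
      "map ?t (rev [0..<2 * Suc n + 1]) = [?t (2 * n + 2), ?t (2 * n + 1)] @ map ?t (rev [0..<2 * n + 1])"
      by simp_all
    have 1: "?t (2 * n + 1) \<otimes> ?t (2 * n + 2) = ?t n \<otimes> ?t (n + 1)"
      and 2: "?t (2 * n + 2) \<otimes> ?t (2 * n + 1) = ?t (n + 1) \<otimes> ?t n"
      by (rule refl_g_rotate; simp)+
    have "wp (map ?t [0..<2 * Suc n + 1]) = ?t n \<otimes> (?t (2 * n + 1) \<otimes> ?t (2 * n + 2))"
      unfolding eq using Suc t by (subst word_prod_append) (auto simp: t_list)
    also have "\<dots> = ?t (Suc n)"
      unfolding 1 using t refl_square[OF g_root] by (simp add: m_assoc[symmetric])
    finally have "wp (map ?t [0..<2 * Suc n + 1]) = ?t (Suc n)" .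
    moreover have "wp (map ?t (rev [0..<2 * Suc n + 1])) = (?t (2 * n + 2) \<otimes> ?t (2 * n + 1)) \<otimes> ?t n"
      unfolding eq using Suc t by (subst word_prod_append) (auto simp: t_list)
    then have "wp (map ?t (rev [0..<2 * Suc n + 1])) = ?t (Suc n)"
      unfolding 2 using t refl_square[OF g_root] by (simp add: m_assoc)
    ultimately show ?case ..
  qed (simp add: t)
  then show "wp (map ?t [0..<2 * n + 1]) = ?t n" "wp (map ?t (rev [0..<2 * n + 1])) = ?t n"
    by blast+
qed

end

end

section \<open>The Bruhat operators\<close>

lemma poly_mapping_sum_singles:
  "f = (\<Sum>k\<in>Poly_Mapping.keys f. Poly_Mapping.single k (Poly_Mapping.lookup f k))"
  by (rule poly_mapping_eqI) (auto simp: lookup_sum lookup_single when_def in_keys_iff)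

lemma single_eq_scaleR: "Poly_Mapping.single k r = r *\<^sub>R Poly_Mapping.single k (1::real)"
  by (rule poly_mapping_eqI) (auto simp: lookup_scaleR lookup_single when_def)

lemma linear_foldr:
  assumes "\<And>v. linear (T v)"
  shows "linear (foldr T xs)"
proof (induction xs)
  case (Cons v xs)
  then show ?case using linear_compose[OF Cons assms[of v]] by (simp add: o_def)
qed (simp add: linear_id[unfolded id_def] id_def)

lemma group_ring_iff: "f \<in> group_ring W \<longleftrightarrow> (\<forall>k. k \<notin> carrier W \<longrightarrow> Poly_Mapping.lookup f k = 0)"
  by (auto simp: group_ring_def in_keys_iff)

lemma subspace_group_ring: "subspace (group_ring W)"
  by (auto simp: subspace_def group_ring_iff lookup_add lookup_scaleR)

lemma single_group_ring: "w \<in> carrier W \<Longrightarrow> Poly_Mapping.single w r \<in> group_ring W"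
  by (auto simp: group_ring_def)

context normalized_coxeter_system
begin

definition bruhat_step :: "('a \<Rightarrow>\<^sub>0 real) \<Rightarrow> 'a \<Rightarrow> 'a \<Rightarrow>\<^sub>0 real" where
  "bruhat_step v w = (if len (w \<otimes> refl_of v) = len w + 1
     then Poly_Mapping.single (w \<otimes> refl_of v) 1 else 0)"

text \<open>\<open>bruhat_operator\<close> without the restriction to the group ring, so that it is
  a total map to which \<open>linear\<close> applies. The restriction returns in
  \<open>bruhat_rep\<close>.\<close>

definition bruhat_op :: "('a \<Rightarrow>\<^sub>0 real) \<Rightarrow> ('a \<Rightarrow>\<^sub>0 real) \<Rightarrow> ('a \<Rightarrow>\<^sub>0 real)" where
  "bruhat_op v f = (\<Sum>w\<in>carrier W. Poly_Mapping.lookup f w *\<^sub>R bruhat_step v w)"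

definition signed_op :: "('a \<Rightarrow>\<^sub>0 real) \<Rightarrow> ('a \<Rightarrow>\<^sub>0 real) \<Rightarrow> ('a \<Rightarrow>\<^sub>0 real)" where
  "signed_op v f = (if v \<in> \<Delta>p then bruhat_op v f else - bruhat_op v f)"

lemma bruhat_operator_eq: "bruhat_operator W S v = restrict (bruhat_op v) (group_ring W)"
  unfolding bruhat_operator_def bruhat_op_def[abs_def] bruhat_step_def Let_def ..

lemma linear_bruhat_op: "linear (bruhat_op v)"
  by (rule linearI)
    (simp_all add: bruhat_op_def lookup_add lookup_scaleR scaleR_add_left sum.distrib
      scaleR_sum_right)

lemma linear_signed_op: "linear (signed_op v)"
proof -
  have "linear (\<lambda>f. - bruhat_op v f)"
    using linear_compose_neg[OF linear_bruhat_op] .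
  then show ?thesis
    using linear_bruhat_op by (cases "v \<in> \<Delta>p") (simp_all add: signed_op_def[abs_def])
qed

lemma bruhat_op_single:
  assumes "w \<in> carrier W"
  shows "bruhat_op v (Poly_Mapping.single w 1) = bruhat_step v w"
proof -
  have "bruhat_op v (Poly_Mapping.single w 1)
      = (\<Sum>u\<in>carrier W. if u = w then bruhat_step v w else 0)"
    unfolding bruhat_op_def by (rule sum.cong) (auto simp: lookup_single)
  then show ?thesis using assms finite_carrier by (simp add: sum.delta')
qed

lemma bruhat_op_group_ring:
  assumes "v \<in> \<Delta>"
  shows "bruhat_op v f \<in> group_ring W"
  unfolding bruhat_op_def bruhat_step_def using assms refl_closed
  by (intro subspace_sum[OF subspace_group_ring] subspace_scale[OF subspace_group_ring])
    (auto intro!: single_group_ring subspace_0[OF subspace_group_ring])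

lemma signed_op_group_ring: "v \<in> \<Delta> \<Longrightarrow> signed_op v f \<in> group_ring W"
  by (simp add: signed_op_def bruhat_op_group_ring subspace_neg[OF subspace_group_ring])

lemma bruhat_op_uminus: "v \<in> \<Delta> \<Longrightarrow> bruhat_op (- v) = bruhat_op v"
  unfolding bruhat_op_def[abs_def] bruhat_step_def by (simp only: refl_uminus)

lemma signed_op_uminus: "v \<in> \<Delta> \<Longrightarrow> signed_op (- v) f = - signed_op v f"
  by (simp add: signed_op_def bruhat_op_uminus pos_root_iff uminus_root nonneg_uminus_root)

lemma linear_eq_0_on_group_ring:
  assumes "linear F" "\<And>w. w \<in> carrier W \<Longrightarrow> F (Poly_Mapping.single w 1) = 0"
    and "f \<in> group_ring W"
  shows "F f = 0"
proof -
  have "F f = (\<Sum>k\<in>Poly_Mapping.keys f. F (Poly_Mapping.single k (Poly_Mapping.lookup f k)))"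
    by (subst poly_mapping_sum_singles) (rule linear_sum[OF assms(1)])
  also have "\<dots> = (\<Sum>k\<in>Poly_Mapping.keys f. Poly_Mapping.lookup f k *\<^sub>R F (Poly_Mapping.single k 1))"
    by (subst single_eq_scaleR) (simp add: linear_scale[OF assms(1)])
  also have "\<dots> = 0"
    using assms(2,3) by (intro sum.neutral) (auto simp: group_ring_def)
  finally show ?thesis .
qed

text \<open>After an ascent from \<open>w\<close> to \<open>w s_v\<close>, the same reflection leads
  back to the shorter \<open>w\<close>, which is not an ascent.\<close>

lemma signed_op_square:
  assumes v: "v \<in> \<Delta>" and f: "f \<in> group_ring W"
  shows "signed_op v (signed_op v f) = 0"
proof (rule linear_eq_0_on_group_ring[OF _ _ f, of "\<lambda>f. signed_op v (signed_op v f)"])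
  show "linear (\<lambda>f. signed_op v (signed_op v f))"
    using linear_compose[OF linear_signed_op linear_signed_op] by (simp add: o_def)
  fix w assume w: "w \<in> carrier W"
  have "bruhat_op v (bruhat_step v w) = 0"
    using w v refl_closed[OF v] linear_0[OF linear_bruhat_op]
    by (auto simp: bruhat_step_def bruhat_op_single mult_refl_refl)
  then show "signed_op v (signed_op v (Poly_Mapping.single w 1)) = 0"
    using linear_neg[OF linear_bruhat_op] w by (simp add: signed_op_def bruhat_op_single)
qed

text \<open>\<open>foldr\<close> applies the last letter first while every operator multiplies on
  the right, so the reflections appear in reversed order. A nonzero value means that each step
  raised the length by one.\<close>

lemma bruhat_word_single:
  assumes "set xs \<subseteq> \<Delta>p" "w \<in> carrier W"
  defines "w' \<equiv> w \<otimes> wp (map refl_of (rev xs))"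
  shows "foldr signed_op xs (Poly_Mapping.single w 1) = 0 \<or>
    len w' = len w + length xs \<and> foldr signed_op xs (Poly_Mapping.single w 1) = Poly_Mapping.single w' 1"
  using assms(1) unfolding w'_def
proof (induction xs)
  case Nil
  then show ?case using assms(2) by simp
next
  case (Cons v xs)
  have roots: "x \<in> \<Delta>" if "x \<in> set (v # xs)" for x
    using that Cons.prems pos_root_iff by auto
  let ?u = "wp (map refl_of (rev xs))"
  have l: "map refl_of (rev xs) \<in> lists (carrier W)"
    using roots refl_closed by auto
  then have u: "?u \<in> carrier W" by (rule word_prod_closed)
  have v: "refl_of v \<in> carrier W" using roots refl_closed by simp
  have "wp (map refl_of (rev (v # xs))) = ?u \<otimes> refl_of v"
    using word_prod_append[OF l, of "[refl_of v]"] v by simp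
  then have w': "w \<otimes> wp (map refl_of (rev (v # xs))) = (w \<otimes> ?u) \<otimes> refl_of v"
    using u v assms(2) by (simp add: m_assoc)
  have "foldr signed_op xs (Poly_Mapping.single w 1) = 0 \<or>
      len (w \<otimes> ?u) = len w + length xs \<and>
      foldr signed_op xs (Poly_Mapping.single w 1) = Poly_Mapping.single (w \<otimes> ?u) 1"
    using Cons by simp
  then show ?case
  proof (elim disjE conjE)
    assume "foldr signed_op xs (Poly_Mapping.single w 1) = 0"
    then show ?thesis using linear_0[OF linear_signed_op] by simp
  next
    assume *: "len (w \<otimes> ?u) = len w + length xs"
      "foldr signed_op xs (Poly_Mapping.single w 1) = Poly_Mapping.single (w \<otimes> ?u) 1"
    have "foldr signed_op (v # xs) (Poly_Mapping.single w 1) = bruhat_step v (w \<otimes> ?u)"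
      using *(2) Cons.prems u assms(2) by (simp add: signed_op_def bruhat_op_single)
    then show ?thesis
      unfolding w' using *(1) by (simp add: bruhat_step_def)
  qed
qed

lemma bruhat_word_eq_0:
  assumes "set xs \<subseteq> \<Delta>p" "xs \<noteq> []" "wp (map refl_of (rev xs)) = \<one>" "f \<in> group_ring W"
  shows "foldr signed_op xs f = 0"
proof (rule linear_eq_0_on_group_ring[OF linear_foldr[OF linear_signed_op] _ assms(4)])
  fix w assume "w \<in> carrier W"
  then show "foldr signed_op xs (Poly_Mapping.single w 1) = 0"
    using bruhat_word_single[OF assms(1), of w] assms(2,3) by simp
qed

text \<open>As \<open>2 * k < m\<close>, only positive roots occur and no signs arise. The run of
  \<open>2 * k + 1\<close> reflections multiplies in either order to the middle one, which the extra
  letter cancels.\<close>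

lemma bruhat_relation_iv:
  assumes g: "dihedral_sequence W S c m g" and k: "2 * k < m" and f: "f \<in> group_ring W"
    and xs: "xs = [0..<2 * k + 1] \<or> xs = rev [0..<2 * k + 1]"
    and ys: "ys = k # xs \<or> ys = xs @ [k]"
  shows "foldr signed_op (map g ys) f = 0"
proof (rule bruhat_word_eq_0[OF _ _ _ f])
  have "set ys \<subseteq> {..<m}" using xs ys k by auto
  then show "set (map g ys) \<subseteq> \<Delta>p"
    using g unfolding dihedral_sequence_def by auto
  show "map g ys \<noteq> []" using ys by auto
  let ?t = "\<lambda>i. refl_of (g i)"
  have t: "?t i \<in> carrier W" for i using refl_closed dihedral_sequence_root[OF g] by blast
  have t_list: "map ?t zs \<in> lists (carrier W)" for zs using t by auto
  have "wp (map ?t (rev xs)) = ?t k"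
    using xs prod_refl_g[OF g, of k] by auto
  then have "wp (map ?t (rev ys)) = ?t k \<otimes> ?t k"
    using ys t word_prod_append[OF t_list t_list, of "rev xs" "[k]"] by auto
  then show "wp (map refl_of (rev (map g ys))) = \<one>"
    using refl_square[OF dihedral_sequence_root[OF g]] by (simp add: rev_map o_def)
qed

lemma bruhat_relation_iii:
  assumes g: "dihedral_sequence W S c m g" and k: "1 \<le> k" "2 * k \<le> m" and f: "f \<in> group_ring W"
  shows "(\<Sum>i<m. signed_op (g i) (signed_op (g (i + k)) f)) = 0"
proof (rule linear_eq_0_on_group_ring[OF _ _ f, of "\<lambda>f. \<Sum>i<m. signed_op (g i) (signed_op (g (i + k)) f)"])
  show "linear (\<lambda>f. \<Sum>i<m. signed_op (g i) (signed_op (g (i + k)) f))"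
    using linear_compose[OF linear_signed_op linear_signed_op]
    by (intro linear_compose_sum ballI) (simp add: o_def)
  fix w assume w: "w \<in> carrier W"
  let ?t = "\<lambda>i. refl_of (g i)"
  have root: "g i \<in> \<Delta>" for i using g by (rule dihedral_sequence_root)
  have pos: "g i \<in> \<Delta>p" if "i < m" for i using that g by (simp add: dihedral_sequence_def)
  have shift: "g (j + m) = - g j" for j using g by (simp add: dihedral_sequence_def)
  have t: "?t i \<in> carrier W" for i using refl_closed root by blast
  \<comment> \<open>The rotation common to all terms. The right-hand operator acts first, so the
    reflection in \<open>g (i + k)\<close> precedes that in \<open>g i\<close>.\<close>
  define r where "r = ?t k \<otimes> ?t 0"
  have r: "?t (i + k) \<otimes> ?t i = r" for i
    unfolding r_def by (rule refl_g_rotate[OF g]) simp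
  have wr: "w \<otimes> ?t (i + k) \<otimes> ?t i = w \<otimes> r" for i
    using w t r[of i] by (simp add: m_assoc)
  \<comment> \<open>For \<open>i < m\<close> the root \<open>g i\<close> is positive, so a sign can
    come only from \<open>g (i + k)\<close>, which is the negative of a positive root once
    \<open>i + k\<close> reaches \<open>m\<close>.\<close>
  define sgn where "sgn i = (if i + k < m then 1 else -1 :: real)" for i
  have sgn: "signed_op (g (i + k)) x = sgn i *\<^sub>R bruhat_op (g (i + k)) x" if "i < m" for i x
  proof (cases "i + k < m")
    case True
    then show ?thesis using pos by (simp add: signed_op_def sgn_def)
  next
    case False
    then have "g (i + k) = - g (i + k - m)" "i + k - m < m"
      using shift[of "i + k - m"] that k by simp_all
    then have "g (i + k) \<notin> \<Delta>p"
      using pos[of "i + k - m"] nonneg_uminus_root root by (simp add: pos_root_iff)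
    then show ?thesis using False by (simp add: signed_op_def sgn_def)
  qed
  define cov where "cov i \<longleftrightarrow> len (w \<otimes> ?t (i + k)) = len w + 1 \<and> len (w \<otimes> r) = len w + 2" for i
  have summand: "signed_op (g i) (signed_op (g (i + k)) (Poly_Mapping.single w 1))
      = (if cov i then sgn i else 0) *\<^sub>R Poly_Mapping.single (w \<otimes> r) 1" if i: "i < m" for i
  proof -
    have "bruhat_op (g i) (bruhat_step (g (i + k)) w)
        = (if cov i then Poly_Mapping.single (w \<otimes> r) 1 else 0)"
      using w t linear_0[OF linear_bruhat_op]
      by (auto simp: bruhat_step_def bruhat_op_single wr cov_def)
    then show ?thesis
      using linear_scale[OF linear_bruhat_op] w signed_op_def[of "g i"] pos[OF i]
      by (simp add: sgn[OF i] bruhat_op_single)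
  qed
  define up where "up j \<longleftrightarrow> nonneg (act w (g j))" for j
  have "(\<Sum>i<m. if cov i then sgn i else 0) = 0"
  proof (cases "len (w \<otimes> r) = len w + 2")
    case True
    have cov: "cov i \<longleftrightarrow> (if i + k < m then up (i + k) else \<not> up (i + k)) \<and> \<not> up (i + 2 * k)"
      if i: "i < m" for i
    proof -
      \<comment> \<open>Two strict rises of total height 2 are rises by exactly 1, so the exact
        length conditions can be replaced by signs of roots.\<close>
      have "cov i \<longleftrightarrow> len w < len (w \<otimes> ?t (i + k)) \<and>
          len (w \<otimes> ?t (i + k)) < len (w \<otimes> ?t (i + k) \<otimes> ?t i)"
        unfolding cov_def wr using True by auto
      also have "len (w \<otimes> ?t (i + k)) < len (w \<otimes> ?t (i + k) \<otimes> ?t i) \<longleftrightarrow> \<not> up (i + 2 * k)"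
        using len_less_refl_iff[of "g i" "w \<otimes> ?t (i + k)"] nonneg_act_refl_g[OF g w, of i k]
          pos[OF i] w t by (simp add: up_def pos_root_iff)
      also have "len w < len (w \<otimes> ?t (i + k)) \<longleftrightarrow> (if i + k < m then up (i + k) else \<not> up (i + k))"
      proof (cases "i + k < m")
        case True
        then show ?thesis
          using len_less_refl_iff[of "g (i + k)" w] pos[OF True] w by (simp add: up_def pos_root_iff)
      next
        case False
        \<comment> \<open>The reflection is that in the positive root \<open>g j\<close>, while
          \<open>up (i + k)\<close> tests \<open>- g j\<close>; hence the negation.\<close>
        define j where "j = i + k - m"
        have j: "i + k = j + m" "j < m" using False i k by (simp_all add: j_def)
        show ?thesis
          unfolding up_def j(1) refl_g_shift[OF g] nonneg_act_g_shift[OF g w]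
          using len_less_refl_iff[of "g j" w] pos[OF j(2)] w by (simp add: pos_root_iff)
      qed
      finally show ?thesis .
    qed
    \<comment> \<open>The indices of the surviving terms with sign + and with sign -.\<close>
    define P where "P = {i. i + k < m \<and> up (i + k) \<and> \<not> up (i + 2 * k)}"
    define N where "N = {i. i < m \<and> m \<le> i + k \<and> \<not> up (i + k) \<and> \<not> up (i + 2 * k)}"
    have PN: "{..<m} \<inter> P = P" "{..<m} \<inter> N = N" by (auto simp: P_def N_def)
    have "(\<Sum>i<m. if cov i then sgn i else 0)
        = (\<Sum>i<m. (if i \<in> P then 1 else 0) - (if i \<in> N then 1 else 0))"
      by (rule sum.cong) (auto simp: cov sgn_def P_def N_def)
    also have "\<dots> = real (card P) - real (card N)"
      by (simp add: sum_subtractf sum.If_cases PN)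
    also have "card P = card N"
      unfolding P_def N_def by (rule antiperiodic_count[OF _ _ k])
        (use nonneg_act_g_shift[OF g w] nonneg_act_g_convex[OF g w] in \<open>auto simp: up_def\<close>)
    finally show ?thesis by simp
  next
    case False
    then show ?thesis by (simp add: cov_def)
  qed
  then show "(\<Sum>i<m. signed_op (g i) (signed_op (g (i + k)) (Poly_Mapping.single w 1))) = 0"
    by (simp add: summand scaleR_sum_left[symmetric])
qed

end

section \<open>The free algebra and its quotient\<close>

lemma free_algebra_simps [simp]:
  "carrier (free_algebra D) = {f. Poly_Mapping.keys f \<subseteq> lists D}"
  "x \<otimes>\<^bsub>free_algebra D\<^esub> y = x * y" "\<one>\<^bsub>free_algebra D\<^esub> = 1"
  "\<zero>\<^bsub>free_algebra D\<^esub> = 0" "x \<oplus>\<^bsub>free_algebra D\<^esub> y = x + y"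
  by (simp_all add: free_algebra_def)

lemma free_carrier_add:
  "Poly_Mapping.keys f \<subseteq> A \<Longrightarrow> Poly_Mapping.keys g \<subseteq> A \<Longrightarrow> Poly_Mapping.keys (f + g) \<subseteq> A"
  using keys_add[of f g] by blast

lemma free_carrier_sum:
  "(\<And>i. i \<in> A \<Longrightarrow> Poly_Mapping.keys (f i) \<subseteq> B) \<Longrightarrow> Poly_Mapping.keys (sum f A) \<subseteq> B"
  by (induction A rule: infinite_finite_induct) (simp_all add: free_carrier_add)

lemma free_carrier_mult:
  assumes "Poly_Mapping.keys f \<subseteq> lists D" "Poly_Mapping.keys g \<subseteq> lists D"
  shows "Poly_Mapping.keys (f * g) \<subseteq> lists D"
proof
  fix k assume "k \<in> Poly_Mapping.keys (f * g)"
  then obtain a b where "k = a + b" "a \<in> Poly_Mapping.keys f" "b \<in> Poly_Mapping.keys g"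
    using keys_mult[of f g] by blast
  then show "k \<in> lists D" using assms by (auto simp: plus_list_def)
qed

lemma one_eq_single: "(1 :: 'v list \<Rightarrow>\<^sub>0 real) = Poly_Mapping.single [] 1"
  by (simp add: single_one[symmetric] zero_list_def)

lemma zero_in_lists [simp]: "0 \<in> lists D"
  by (simp add: zero_list_def)

lemma free_carrier_scale:
  "Poly_Mapping.keys f \<subseteq> A \<Longrightarrow> Poly_Mapping.keys (r *\<^sub>R f :: _ \<Rightarrow>\<^sub>0 real) \<subseteq> A"
  by (auto simp: in_keys_iff lookup_scaleR)

lemma free_carrier_gen: "v \<in> D \<Longrightarrow> Poly_Mapping.keys (free_gen v) \<subseteq> lists D"
  by (simp add: free_gen_def)

lemma ring_free_algebra: "ring (free_algebra D)"
proof (rule ringI)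
  show "abelian_group (free_algebra D)"
  proof (rule abelian_groupI)
    fix x assume x: "x \<in> carrier (free_algebra D)"
    have "Poly_Mapping.keys (- x) = Poly_Mapping.keys x"
      by (simp add: keys_eq_empty set_eq_iff in_keys_iff)
    then show "\<exists>y\<in>carrier (free_algebra D). y \<oplus>\<^bsub>free_algebra D\<^esub> x = \<zero>\<^bsub>free_algebra D\<^esub>"
      using x by (intro bexI[of _ "- x"]) auto
  qed (simp_all add: free_carrier_add algebra_simps)
  show "monoid (free_algebra D)"
    by (rule monoidI) (simp_all add: free_carrier_mult mult.assoc)
qed (simp_all add: algebra_simps)

lemma minus_free_algebra:
  assumes "f \<in> carrier (free_algebra D)" "g \<in> carrier (free_algebra D)"
  shows "f \<ominus>\<^bsub>free_algebra D\<^esub> g = f - g"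
proof -
  interpret F: ring "free_algebra D" by (rule ring_free_algebra)
  have "- g \<in> carrier (free_algebra D)"
    using assms(2) by (auto simp: in_keys_iff)
  then have "\<ominus>\<^bsub>free_algebra D\<^esub> g = - g"
    using assms by (intro F.minus_equality) auto
  then show ?thesis by (simp add: a_minus_def)
qed

lemma prod_list_free_gen:
  "prod_list (map (\<lambda>i. free_gen (g i)) is) = Poly_Mapping.single (map g is) 1"
  by (induction "is") (simp_all add: one_eq_single free_gen_def mult_single plus_list_def)

text \<open>The extension of \<open>T\<close> from the generators to the free algebra given by its
  universal property: a word acts by composing the operators of its letters.\<close>

definition free_eval :: "('v \<Rightarrow> 'u \<Rightarrow> 'u::real_vector) \<Rightarrow> ('v list \<Rightarrow>\<^sub>0 real) \<Rightarrow> 'u \<Rightarrow> 'u" where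
  "free_eval T f x = (\<Sum>xs\<in>Poly_Mapping.keys f. Poly_Mapping.lookup f xs *\<^sub>R foldr T xs x)"

lemma free_eval_superset:
  assumes "finite A" "Poly_Mapping.keys f \<subseteq> A"
  shows "free_eval T f x = (\<Sum>xs\<in>A. Poly_Mapping.lookup f xs *\<^sub>R foldr T xs x)"
  unfolding free_eval_def using assms
  by (intro sum.mono_neutral_left) (auto simp: in_keys_iff)

lemma free_eval_single: "free_eval T (Poly_Mapping.single xs r) x = r *\<^sub>R foldr T xs x"
  by (subst free_eval_superset[of "{xs}"]) auto

lemma free_eval_add: "free_eval T (f + g) x = free_eval T f x + free_eval T g x"
proof -
  let ?A = "Poly_Mapping.keys f \<union> Poly_Mapping.keys g"
  show ?thesis
    using free_eval_superset[of ?A f T x] free_eval_superset[of ?A g T x]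
      free_eval_superset[of ?A "f + g" T x] keys_add[of f g]
    by (simp add: lookup_add scaleR_add_left sum.distrib)
qed

lemma free_eval_zero: "free_eval T 0 x = 0"
  by (simp add: free_eval_def)

lemma free_eval_scale: "free_eval T (r *\<^sub>R f) x = r *\<^sub>R free_eval T f x"
  by (subst free_eval_superset[of "Poly_Mapping.keys f"])
    (auto simp: free_carrier_scale lookup_scaleR free_eval_def scaleR_sum_right)

lemma free_eval_diff: "free_eval T (f - g) x = free_eval T f x - free_eval T g x"
  using free_eval_add[of T "f - g" g x] by simp

lemma free_eval_sum: "free_eval T (\<Sum>i\<in>A. f i) x = (\<Sum>i\<in>A. free_eval T (f i) x)"
  by (induction A rule: infinite_finite_induct) (simp_all add: free_eval_add free_eval_zero)

lemma linear_free_eval: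
  assumes "\<And>v. linear (T v)"
  shows "linear (free_eval T f)"
proof -
  have "linear (\<lambda>x. \<Sum>xs\<in>Poly_Mapping.keys f. Poly_Mapping.lookup f xs *\<^sub>R foldr T xs x)"
    by (intro linear_compose_sum ballI linear_compose_scale_right linear_foldr assms)
  then show ?thesis by (simp add: free_eval_def[abs_def])
qed

lemma free_eval_mult:
  assumes "\<And>v. linear (T v)"
  shows "free_eval T (f * g) x = free_eval T f (free_eval T g x)"
proof -
  let ?l = Poly_Mapping.lookup and ?k = Poly_Mapping.keys
  have "f * g = (\<Sum>a\<in>?k f. Poly_Mapping.single a (?l f a)) * (\<Sum>b\<in>?k g. Poly_Mapping.single b (?l g b))"
    using arg_cong2[OF poly_mapping_sum_singles[of f] poly_mapping_sum_singles[of g], of "(*)"] .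
  also have "\<dots> = (\<Sum>a\<in>?k f. \<Sum>b\<in>?k g. Poly_Mapping.single (a @ b) (?l f a * ?l g b))"
    by (simp add: sum_product mult_single plus_list_def)
  finally have "free_eval T (f * g) x
      = (\<Sum>a\<in>?k f. \<Sum>b\<in>?k g. (?l f a * ?l g b) *\<^sub>R foldr T a (foldr T b x))"
    by (simp add: free_eval_sum free_eval_single)
  also have "\<dots> = (\<Sum>a\<in>?k f. ?l f a *\<^sub>R foldr T a (free_eval T g x))"
    unfolding free_eval_def
    by (simp add: linear_sum[OF linear_foldr[OF assms]] linear_scale[OF linear_foldr[OF assms]]
        scaleR_sum_right)
  also have "\<dots> = free_eval T f (free_eval T g x)"
    by (simp add: free_eval_def)
  finally show ?thesis .
qed

lemma free_eval_closed:
  assumes U: "subspace U" and T: "\<And>v x. v \<in> D \<Longrightarrow> x \<in> U \<Longrightarrow> T v x \<in> U"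
    and "Poly_Mapping.keys f \<subseteq> lists D" "x \<in> U"
  shows "free_eval T f x \<in> U"
  unfolding free_eval_def
proof (intro subspace_sum[OF U] subspace_scale[OF U])
  fix xs assume "xs \<in> Poly_Mapping.keys f"
  then have "xs \<in> lists D" using assms by blast
  then show "foldr T xs x \<in> U"
    by (induction xs) (use assms in auto)
qed

text \<open>Vanishing is tested only on \<open>U\<close>, so for right multiples
  \<open>a * x\<close> the invariance of \<open>U\<close> is essential; for left multiples
  \<open>x * a\<close> it is enough that linear operators send 0 to 0.\<close>

lemma ideal_free_eval_kernel:
  assumes U: "subspace U" and T: "\<And>v x. v \<in> D \<Longrightarrow> x \<in> U \<Longrightarrow> T v x \<in> U"
    and lin: "\<And>v. linear (T v)"
  shows "ideal {f \<in> carrier (free_algebra D). \<forall>x\<in>U. free_eval T f x = 0} (free_algebra D)"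
    (is "ideal ?K ?F")
proof (rule idealI)
  interpret F: ring ?F by (rule ring_free_algebra)
  show "ring ?F" by (rule ring_free_algebra)
  show "subgroup ?K (add_monoid ?F)"
  proof (rule F.add.subgroupI)
    show "?K \<noteq> {}" by (auto intro!: exI[of _ 0] simp: free_eval_zero)
    fix a assume a: "a \<in> ?K"
    then have "\<ominus>\<^bsub>?F\<^esub> a = 0 - a"
      using minus_free_algebra[of 0 D a] F.minus_closed F.a_inv_closed[of a]
      by (simp add: a_minus_def)
    moreover have "\<ominus>\<^bsub>?F\<^esub> a \<in> carrier ?F" using a F.a_inv_closed by blast
    ultimately show "\<ominus>\<^bsub>?F\<^esub> a \<in> ?K"
      using a by (simp add: free_eval_diff free_eval_zero del: diff_0)
  qed (auto simp: free_eval_add free_carrier_add subset_eq dest: free_carrier_add[THEN subsetD, rotated 2])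
  fix a x assume "a \<in> ?K" "x \<in> carrier ?F"
  then show "x \<otimes>\<^bsub>?F\<^esub> a \<in> ?K" "a \<otimes>\<^bsub>?F\<^esub> x \<in> ?K"
    using free_eval_closed[where T = T and D = D, OF U T]
      linear_0[OF linear_free_eval[of T, OF lin]]
    by (simp_all add: free_carrier_mult free_eval_mult[of T, OF lin])
qed

section \<open>The endomorphism algebra and algebra homomorphisms\<close>

lemma End_algebra_simps [simp]:
  "S \<otimes>\<^bsub>End_algebra U\<^esub> T = compose U S T" "\<one>\<^bsub>End_algebra U\<^esub> = (\<lambda>x\<in>U. x)"
  "S \<oplus>\<^bsub>End_algebra U\<^esub> T = (\<lambda>x\<in>U. S x + T x)" "\<zero>\<^bsub>End_algebra U\<^esub> = (\<lambda>x\<in>U. 0)"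
  "r \<odot>\<^bsub>End_algebra U\<^esub> T = (\<lambda>x\<in>U. r *\<^sub>R T x)"
  by (simp_all add: End_algebra_def)

lemma restrict_End_algebra:
  assumes "subspace U" "linear F" "F ` U \<subseteq> U"
  shows "restrict F U \<in> carrier (End_algebra U)"
  using assms by (auto simp: End_algebra_def subspace_add subspace_scale linear_add linear_scale)

text \<open>The additive inverse is a definite description and is evaluated directly, without first
  making \<open>End_algebra\<close> a ring: an inverse is determined pointwise on \<open>U\<close>
  and by extensionality outside.\<close>

lemma a_inv_End_algebra:
  assumes U: "subspace U" and "linear F" "F ` U \<subseteq> U"
  shows "\<ominus>\<^bsub>End_algebra U\<^esub> restrict F U = (\<lambda>x\<in>U. - F x)"
  unfolding a_inv_def m_inv_def
proof (rule the_equality)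
  have "(\<lambda>x\<in>U. - F x) \<in> carrier (End_algebra U)"
    by (rule restrict_End_algebra[OF U linear_compose_neg[OF assms(2)]])
      (use assms(3) subspace_neg[OF U] in auto)
  then show "(\<lambda>x\<in>U. - F x) \<in> carrier (add_monoid (End_algebra U)) \<and>
    restrict F U \<otimes>\<^bsub>add_monoid (End_algebra U)\<^esub> (\<lambda>x\<in>U. - F x) = \<one>\<^bsub>add_monoid (End_algebra U)\<^esub> \<and>
    (\<lambda>x\<in>U. - F x) \<otimes>\<^bsub>add_monoid (End_algebra U)\<^esub> restrict F U = \<one>\<^bsub>add_monoid (End_algebra U)\<^esub>"
    by (auto simp: restrict_def fun_eq_iff)
  fix G assume G: "G \<in> carrier (add_monoid (End_algebra U)) \<and>
    restrict F U \<otimes>\<^bsub>add_monoid (End_algebra U)\<^esub> G = \<one>\<^bsub>add_monoid (End_algebra U)\<^esub> \<and>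
    G \<otimes>\<^bsub>add_monoid (End_algebra U)\<^esub> restrict F U = \<one>\<^bsub>add_monoid (End_algebra U)\<^esub>"
  then have "G \<in> extensional U" by (simp add: End_algebra_def PiE_def)
  moreover have "G x = - F x" if "x \<in> U" for x
    using G that by (auto simp: restrict_def fun_eq_iff add_eq_0_iff dest: spec[of _ x])
  ultimately show "G = (\<lambda>x\<in>U. - F x)"
    by (intro extensionalityI[of _ U]) auto
qed

lemma algebra_homD:
  assumes "h \<in> algebra_hom A B"
  shows "X \<in> carrier A \<Longrightarrow> h X \<in> carrier B"
    and "X \<in> carrier A \<Longrightarrow> Y \<in> carrier A \<Longrightarrow> h (X \<otimes>\<^bsub>A\<^esub> Y) = h X \<otimes>\<^bsub>B\<^esub> h Y"
    and "X \<in> carrier A \<Longrightarrow> Y \<in> carrier A \<Longrightarrow> h (X \<oplus>\<^bsub>A\<^esub> Y) = h X \<oplus>\<^bsub>B\<^esub> h Y"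
    and "h \<one>\<^bsub>A\<^esub> = \<one>\<^bsub>B\<^esub>"
    and "X \<in> carrier A \<Longrightarrow> h (r \<odot>\<^bsub>A\<^esub> X) = r \<odot>\<^bsub>B\<^esub> h X"
  using assms by (auto simp: algebra_hom_def ring_hom_def)

section \<open>The bracket algebra and its representation on the group ring\<close>

context normalized_coxeter_system
begin

abbreviation "\<F> \<equiv> free_algebra \<Delta>"
abbreviation "\<A> \<equiv> bracket_algebra W S c"
abbreviation "cls \<equiv> bracket_class W S c"

lemma bracket_relations_carrier: "bracket_relations W S c \<subseteq> carrier \<F>"
proof
  fix f assume "f \<in> bracket_relations W S c"
  then consider v where "v \<in> \<Delta>" "f = free_gen (- v) + free_gen v"
    | v where "v \<in> \<Delta>" "f = free_gen v * free_gen v"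
    | m g k where "dihedral_sequence W S c m g" "f = (\<Sum>i<m. free_gen (g i) * free_gen (g (i + k)))"
    | m g where "dihedral_sequence W S c m g"
      "f = (let k = m div 2 - 1; up = map (\<lambda>i. free_gen (g i)) [0..<2 * k + 1]; x = free_gen (g k) in
        x * prod_list up + prod_list up * x + x * prod_list (rev up) + prod_list (rev up) * x)"
    unfolding bracket_relations_def by blast
  then show "f \<in> carrier \<F>"
  proof cases
    case 1
    then show ?thesis by (simp add: free_carrier_add free_carrier_gen uminus_root)
  next
    case 2
    then show ?thesis by (simp add: free_carrier_mult free_carrier_gen)
  next
    case 3
    then show ?thesis
      by (simp add: free_carrier_sum free_carrier_mult free_carrier_gen dihedral_sequence_root)
  next
    case 4
    have "Poly_Mapping.keys (prod_list (map (\<lambda>i. free_gen (g i)) js)) \<subseteq> lists \<Delta>" for js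
      using dihedral_sequence_root[OF 4(1)] by (auto simp: prod_list_free_gen)
    then show ?thesis
      unfolding 4(2) Let_def rev_map
      by (simp add: free_carrier_mult free_carrier_add free_carrier_gen dihedral_sequence_root[OF 4(1)])
  qed
qed

lemma bracket_ideal: "ideal (bracket_ideal W S c) \<F>"
  unfolding bracket_ideal_def
  using ring.genideal_ideal[OF ring_free_algebra bracket_relations_carrier] .

lemma bracket_algebra_carrier: "carrier \<A> = cls ` carrier \<F>"
  by (auto simp: bracket_algebra_def bracket_class_def Let_def FactRing_def A_RCOSETS_def'
      simp del: free_algebra_simps(1))

lemma bracket_algebra_ops:
  assumes "f \<in> carrier \<F>" "g \<in> carrier \<F>"
  shows "cls f \<otimes>\<^bsub>\<A>\<^esub> cls g = cls (f * g)" "cls f \<oplus>\<^bsub>\<A>\<^esub> cls g = cls (f + g)"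
    "\<one>\<^bsub>\<A>\<^esub> = cls 1" "r \<odot>\<^bsub>\<A>\<^esub> cls f = cls (r *\<^sub>R f)"
proof -
  interpret I: ideal "bracket_ideal W S c" \<F> by (rule bracket_ideal)
  have r1: "r *\<^sub>R 1 \<in> carrier \<F>" by (simp add: free_carrier_scale)
  have mult: "rcoset_mult \<F> (bracket_ideal W S c) (cls f) (cls g) = cls (f * g)"
    if "f \<in> carrier \<F>" "g \<in> carrier \<F>" for f g
    using I.rcoset_mult_add[OF that] by (simp add: bracket_class_def)
  show "cls f \<otimes>\<^bsub>\<A>\<^esub> cls g = cls (f * g)"
    using mult[OF assms] by (simp add: bracket_algebra_def Let_def FactRing_def)
  show "cls f \<oplus>\<^bsub>\<A>\<^esub> cls g = cls (f + g)"
    using I.a_rcos_sum[OF assms] by (simp add: bracket_algebra_def Let_def FactRing_def bracket_class_def)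
  show "\<one>\<^bsub>\<A>\<^esub> = cls 1"
    by (simp add: bracket_algebra_def Let_def FactRing_def bracket_class_def)
  \<comment> \<open>Scalars act on the quotient as multiplication by the class of
    \<open>r 1\<close>, so this product has to be identified with scaling in the free algebra; it is
    checked on single words.\<close>
  have "r *\<^sub>R 1 * f = r *\<^sub>R f"
  proof -
    have "r *\<^sub>R 1 * Poly_Mapping.single k s = r *\<^sub>R Poly_Mapping.single k s" for k :: "('a \<Rightarrow>\<^sub>0 real) list" and s :: real
      by (subst (1) one_eq_single, subst (1) single_eq_scaleR[symmetric], subst mult_single,
          subst (2) single_eq_scaleR, simp add: plus_list_def single_eq_scaleR[of k "r * s"])
    then show ?thesis
      by (subst (1 2) poly_mapping_sum_singles[of f]) (simp add: sum_distrib_left scaleR_sum_right)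
  qed
  then show "r \<odot>\<^bsub>\<A>\<^esub> cls f = cls (r *\<^sub>R f)"
    using mult[OF r1 assms(1)] by (simp add: bracket_algebra_def Let_def FactRing_def)
qed

lemma cls_carrier: "f \<in> carrier \<F> \<Longrightarrow> cls f \<in> carrier \<A>"
  by (simp add: bracket_algebra_carrier)

text \<open>The generator classes generate the algebra: agreement passes to products, scalar
  multiples and sums, hence to words and their linear combinations.\<close>

lemma bracket_hom_eqI:
  assumes h: "h \<in> algebra_hom \<A> Q" and h': "h' \<in> algebra_hom \<A> Q"
    and gen: "\<And>v. v \<in> \<Delta> \<Longrightarrow> h (bracket_gen W S c v) = h' (bracket_gen W S c v)"
    and X: "X \<in> carrier \<A>"
  shows "h X = h' X"
proof -
  have scale: "h (cls (r *\<^sub>R f)) = h' (cls (r *\<^sub>R f))" if "f \<in> carrier \<F>" "h (cls f) = h' (cls f)" for r f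
    using algebra_homD(5)[OF h cls_carrier[OF that(1)], of r]
      algebra_homD(5)[OF h' cls_carrier[OF that(1)], of r] that(2)
    by (simp only: bracket_algebra_ops(4)[OF that(1) that(1)])
  have add: "h (cls (f + g)) = h' (cls (f + g))"
    if "f \<in> carrier \<F>" "g \<in> carrier \<F>" "h (cls f) = h' (cls f)" "h (cls g) = h' (cls g)" for f g
    using algebra_homD(3)[OF h cls_carrier[OF that(1)] cls_carrier[OF that(2)]]
      algebra_homD(3)[OF h' cls_carrier[OF that(1)] cls_carrier[OF that(2)]] that(3,4)
    by (simp only: bracket_algebra_ops(2)[OF that(1,2)])
  have mult: "h (cls (f * g)) = h' (cls (f * g))"
    if "f \<in> carrier \<F>" "g \<in> carrier \<F>" "h (cls f) = h' (cls f)" "h (cls g) = h' (cls g)" for f g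
    using algebra_homD(2)[OF h cls_carrier[OF that(1)] cls_carrier[OF that(2)]]
      algebra_homD(2)[OF h' cls_carrier[OF that(1)] cls_carrier[OF that(2)]] that(3,4)
    by (simp only: bracket_algebra_ops(1)[OF that(1,2)])
  have carr1: "1 \<in> carrier \<F>" by simp
  have one: "h (cls 1) = h' (cls 1)"
    using algebra_homD(4)[OF h] algebra_homD(4)[OF h'] by (simp only: bracket_algebra_ops(3)[OF carr1 carr1])
  have zero: "h (cls 0) = h' (cls 0)"
    using scale[OF carr1 one, of 0] by simp
  have word: "h (cls (Poly_Mapping.single xs 1)) = h' (cls (Poly_Mapping.single xs 1))"
    if "xs \<in> lists \<Delta>" for xs
    using that
  proof (induction xs)
    case Nil
    then show ?case using one by (simp add: one_eq_single)
  next
    case (Cons v xs)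
    have "Poly_Mapping.single (v # xs) 1 = free_gen v * Poly_Mapping.single xs 1"
      by (simp add: free_gen_def mult_single plus_list_def)
    moreover have "free_gen v \<in> carrier \<F>" using Cons by (simp add: free_carrier_gen)
    moreover have "Poly_Mapping.single xs 1 \<in> carrier \<F>" using Cons by simp
    ultimately show ?case
      using mult[of "free_gen v" "Poly_Mapping.single xs 1"] Cons gen by (simp add: bracket_gen_def)
  qed
  obtain f where f: "f \<in> carrier \<F>" "X = cls f"
    using X by (auto simp: bracket_algebra_carrier simp del: free_algebra_simps(1))
  have sums: "h (cls (\<Sum>k\<in>A. Poly_Mapping.single k (Poly_Mapping.lookup f k)))
      = h' (cls (\<Sum>k\<in>A. Poly_Mapping.single k (Poly_Mapping.lookup f k)))"
    if "finite A" "A \<subseteq> lists \<Delta>" for A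
    using that
  proof (induction A rule: finite_induct)
    case empty
    then show ?case using zero by simp
  next
    case (insert k A)
    let ?s = "\<lambda>k. Poly_Mapping.single k (Poly_Mapping.lookup f k)"
    have "Poly_Mapping.single k 1 \<in> carrier \<F>" using insert by simp
    then have "h (cls (?s k)) = h' (cls (?s k))"
      using scale word insert by (subst (1 2) single_eq_scaleR) blast
    moreover have "?s k \<in> carrier \<F>" using insert by simp
    moreover have "(\<Sum>k\<in>A. ?s k) \<in> carrier \<F>"
      unfolding free_algebra_simps mem_Collect_eq using insert by (intro free_carrier_sum) auto
    ultimately have "h (cls (?s k + (\<Sum>k\<in>A. ?s k))) = h' (cls (?s k + (\<Sum>k\<in>A. ?s k)))"
      using insert add by blast
    then show ?case using insert by simp
  qed
  have "Poly_Mapping.keys f \<subseteq> lists \<Delta>" using f(1) by simp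
  from sums[OF finite_keys this] show ?thesis
    unfolding poly_mapping_sum_singles[of f, symmetric] f(2) .
qed

lemma free_eval_bracket_relations:
  assumes "f \<in> bracket_relations W S c" "x \<in> group_ring W"
  shows "free_eval signed_op f x = 0"
proof -
  note mult = free_eval_mult[of signed_op, OF linear_signed_op]
  from assms(1) consider v where "v \<in> \<Delta>" "f = free_gen (- v) + free_gen v"
    | v where "v \<in> \<Delta>" "f = free_gen v * free_gen v"
    | m g k where "dihedral_sequence W S c m g" "1 \<le> k" "2 * k \<le> m"
      "f = (\<Sum>i<m. free_gen (g i) * free_gen (g (i + k)))"
    | m g where "dihedral_sequence W S c m g" "4 \<le> m"
      "f = (let k = m div 2 - 1; up = map (\<lambda>i. free_gen (g i)) [0..<2 * k + 1]; x = free_gen (g k) in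
        x * prod_list up + prod_list up * x + x * prod_list (rev up) + prod_list (rev up) * x)"
    unfolding bracket_relations_def by blast
  then show ?thesis
  proof cases
    case 1
    then show ?thesis by (simp add: free_eval_add free_gen_def free_eval_single signed_op_uminus)
  next
    case 2
    then show ?thesis
      using signed_op_square[OF _ assms(2)] by (simp add: mult free_gen_def free_eval_single)
  next
    case 3
    then show ?thesis
      using bruhat_relation_iii[OF 3(1-3) assms(2)]
      by (simp add: free_eval_sum mult free_gen_def free_eval_single)
  next
    case 4
    define k where "k = m div 2 - 1"
    have k: "2 * k < m" using 4(2) by (simp add: k_def)
    have fg: "free_gen (g k) = Poly_Mapping.single (map g [k]) 1"
      by (simp add: free_gen_def)
    define up where "up = [0..<2 * k + 1]"
    have "f = Poly_Mapping.single (map g (k # up)) 1 + Poly_Mapping.single (map g (up @ [k])) 1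
        + Poly_Mapping.single (map g (k # rev up)) 1 + Poly_Mapping.single (map g (rev up @ [k])) 1"
      unfolding 4(3) Let_def k_def[symmetric] up_def[symmetric] rev_map prod_list_free_gen fg
        mult_single plus_list_def map_append[symmetric] by simp
    moreover have "foldr signed_op (map g ys) x = 0"
      if "ys \<in> {k # up, up @ [k], k # rev up, rev up @ [k]}" for ys
      using that by (elim insertE emptyE; intro bruhat_relation_iv[OF 4(1) k assms(2), of up ys]
          bruhat_relation_iv[OF 4(1) k assms(2), of "rev up" ys]) (simp_all add: up_def)
    ultimately show ?thesis
      by (simp only: free_eval_add free_eval_single insert_iff simp_thms scaleR_zero_right add_0)
  qed
qed

text \<open>The elements that evaluate to zero on the group ring form an ideal containing the
  relations, hence containing the ideal they generate; so evaluation depends only on the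
  class.\<close>

lemma free_eval_bracket_class:
  assumes "f \<in> carrier \<F>" "g \<in> carrier \<F>" "cls f = cls g" "x \<in> group_ring W"
  shows "free_eval signed_op f x = free_eval signed_op g x"
proof -
  let ?K = "{f \<in> carrier \<F>. \<forall>x\<in>group_ring W. free_eval signed_op f x = 0}"
  have "ideal ?K \<F>"
    by (rule ideal_free_eval_kernel[OF subspace_group_ring signed_op_group_ring linear_signed_op])
  then have "bracket_ideal W S c \<subseteq> ?K"
    unfolding bracket_ideal_def
    using bracket_relations_carrier free_eval_bracket_relations
    by (intro ring.genideal_minimal[OF ring_free_algebra]) blast+
  moreover have "f \<ominus>\<^bsub>\<F>\<^esub> g \<in> bracket_ideal W S c"
    using ring.quotient_eq_iff_same_a_r_cos[OF ring_free_algebra bracket_ideal assms(1,2)] assms(3)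
    by (simp add: bracket_class_def)
  ultimately have "free_eval signed_op (f - g) x = 0"
    using assms(4) minus_free_algebra[OF assms(1,2)] by auto
  then show ?thesis by (simp add: free_eval_diff)
qed

text \<open>Any representative of the class would do, by \<open>free_eval_bracket_class\<close>. The
  inner restriction puts values into \<open>End_algebra\<close>; the outer one makes the map
  extensional, as uniqueness demands.\<close>

definition bruhat_rep :: "(('a \<Rightarrow>\<^sub>0 real) list \<Rightarrow>\<^sub>0 real) set \<Rightarrow> ('a \<Rightarrow>\<^sub>0 real) \<Rightarrow> ('a \<Rightarrow>\<^sub>0 real)" where
  "bruhat_rep = (\<lambda>X\<in>carrier \<A>.
     restrict (free_eval signed_op (SOME f. f \<in> carrier \<F> \<and> cls f = X)) (group_ring W))"

lemma bruhat_rep_cls: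
  assumes "f \<in> carrier \<F>"
  shows "bruhat_rep (cls f) = restrict (free_eval signed_op f) (group_ring W)"
proof -
  let ?P = "\<lambda>g. g \<in> carrier \<F> \<and> cls g = cls f"
  have P: "?P (SOME g. ?P g)" by (rule someI[of ?P f]) (use assms in simp)
  have "bruhat_rep (cls f) = restrict (free_eval signed_op (SOME g. ?P g)) (group_ring W)"
    using cls_carrier[OF assms] by (simp add: bruhat_rep_def del: free_algebra_simps(1))
  also have "\<dots> = restrict (free_eval signed_op f) (group_ring W)"
    by (rule restrict_ext) (use P assms free_eval_bracket_class in blast)
  finally show ?thesis .
qed

lemma bruhat_rep_representation: "bruhat_rep \<in> representations \<A> (group_ring W)"
proof -
  let ?U = "group_ring W"
  note lin = linear_free_eval[of signed_op, OF linear_signed_op]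
  have closed: "free_eval signed_op f x \<in> ?U" if "f \<in> carrier \<F>" "x \<in> ?U" for f x
    by (rule free_eval_closed[where D = \<Delta> and T = signed_op, OF subspace_group_ring])
      (use signed_op_group_ring that in simp_all)
  have carr: "f * g \<in> carrier \<F>" "f + g \<in> carrier \<F>" "r *\<^sub>R f \<in> carrier \<F>" "1 \<in> carrier \<F>"
    if "f \<in> carrier \<F>" "g \<in> carrier \<F>" for f g r
    using that by (simp_all add: free_carrier_mult free_carrier_add free_carrier_scale)
  have X: "\<exists>f\<in>carrier \<F>. X = cls f" if "X \<in> carrier \<A>" for X
    using that bracket_algebra_carrier by blast
  show ?thesis
    unfolding representations_def algebra_hom_def
  proof (intro CollectI conjI allI ballI ring_hom_memI)
    fix X assume "X \<in> carrier \<A>"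
    then obtain f where f: "f \<in> carrier \<F>" "X = cls f" using X by blast
    show "bruhat_rep X \<in> carrier (End_algebra ?U)"
      unfolding f(2) bruhat_rep_cls[OF f(1)]
      using closed[OF f(1)] by (intro restrict_End_algebra[OF subspace_group_ring lin]) auto
    show "bruhat_rep (r \<odot>\<^bsub>\<A>\<^esub> X) = r \<odot>\<^bsub>End_algebra ?U\<^esub> bruhat_rep X" for r
      unfolding f(2) bracket_algebra_ops(4)[OF f(1) f(1)] bruhat_rep_cls[OF f(1)]
        bruhat_rep_cls[OF carr(3)[OF f(1) f(1)]]
      by (auto simp: free_eval_scale restrict_def)
    fix Y assume "Y \<in> carrier \<A>"
    then obtain g where g: "g \<in> carrier \<F>" "Y = cls g" using X by blast
    show "bruhat_rep (X \<otimes>\<^bsub>\<A>\<^esub> Y) = bruhat_rep X \<otimes>\<^bsub>End_algebra ?U\<^esub> bruhat_rep Y"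
      unfolding f(2) g(2) bracket_algebra_ops(1)[OF f(1) g(1)] bruhat_rep_cls[OF f(1)]
        bruhat_rep_cls[OF g(1)] bruhat_rep_cls[OF carr(1)[OF f(1) g(1)]]
      using closed[OF g(1)]
      by (auto simp: free_eval_mult[of signed_op, OF linear_signed_op] compose_def restrict_def)
    show "bruhat_rep (X \<oplus>\<^bsub>\<A>\<^esub> Y) = bruhat_rep X \<oplus>\<^bsub>End_algebra ?U\<^esub> bruhat_rep Y"
      unfolding f(2) g(2) bracket_algebra_ops(2)[OF f(1) g(1)] bruhat_rep_cls[OF f(1)]
        bruhat_rep_cls[OF g(1)] bruhat_rep_cls[OF carr(2)[OF f(1) g(1)]]
      by (auto simp: free_eval_add restrict_def)
  next
    have 1: "1 \<in> carrier \<F>" by simp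
    show "bruhat_rep \<one>\<^bsub>\<A>\<^esub> = \<one>\<^bsub>End_algebra ?U\<^esub>"
      unfolding bracket_algebra_ops(3)[OF 1 1] bruhat_rep_cls[OF 1]
      by (auto simp: one_eq_single free_eval_single restrict_def)
  qed
qed

lemma bruhat_rep_gen:
  assumes "v \<in> \<Delta>"
  shows "bruhat_rep (bracket_gen W S c v) = restrict (signed_op v) (group_ring W)"
proof -
  have "free_gen v \<in> carrier \<F>" using assms by (simp add: free_carrier_gen)
  then show ?thesis
    by (simp only: bracket_gen_def bruhat_rep_cls) (auto simp: free_gen_def free_eval_single restrict_def)
qed

lemma a_inv_bruhat_operator:
  assumes "v \<in> \<Delta>p"
  shows "\<ominus>\<^bsub>End_algebra (group_ring W)\<^esub> bruhat_operator W S v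
    = restrict (signed_op (- v)) (group_ring W)"
proof -
  have v: "v \<in> \<Delta>" using assms pos_root_iff by blast
  have "- bruhat_op v x = signed_op (- v) x" for x
    using assms signed_op_uminus[OF v] by (simp add: signed_op_def[of v])
  then show ?thesis
    unfolding bruhat_operator_eq
    using a_inv_End_algebra[OF subspace_group_ring[of W] linear_bruhat_op[of v]] bruhat_op_group_ring[OF v]
    by (simp add: image_subset_iff)
qed

end

theorem theorem3p2:
  fixes W :: "('a, 'x) monoid_scheme" and S :: "'a set" and c :: "'a \<Rightarrow> real"
  assumes "finite_coxeter_system W S"
    and "root_normalization W S c"
  shows "\<exists>!\<rho>. \<rho> \<in> extensional (carrier (bracket_algebra W S c)) \<and>
    \<rho> \<in> representations (bracket_algebra W S c) (group_ring W) \<and>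
    (\<forall>v\<in>pos_roots W S c.
       \<rho> (bracket_gen W S c v) = bruhat_operator W S v \<and>
       \<rho> (bracket_gen W S c (- v)) = \<ominus>\<^bsub>End_algebra (group_ring W)\<^esub> bruhat_operator W S v)"
proof -
  interpret normalized_coxeter_system W S c
    using assms by (simp add: normalized_coxeter_system_def normalized_coxeter_system_axioms_def)
  show ?thesis
  proof (rule ex1I[of _ bruhat_rep], intro conjI ballI)
    show "bruhat_rep \<in> extensional (carrier \<A>)"
      by (simp add: bruhat_rep_def)
    show "bruhat_rep \<in> representations \<A> (group_ring W)"
      by (rule bruhat_rep_representation)
    fix v assume v: "v \<in> \<Delta>p"
    then have root: "v \<in> \<Delta>" using pos_root_iff by blast
    show "bruhat_rep (bracket_gen W S c v) = bruhat_operator W S v"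
      using v by (simp add: bruhat_rep_gen[OF root] bruhat_operator_eq signed_op_def[abs_def])
    show "bruhat_rep (bracket_gen W S c (- v)) = \<ominus>\<^bsub>End_algebra (group_ring W)\<^esub> bruhat_operator W S v"
      by (simp add: bruhat_rep_gen[OF uminus_root[OF root]] a_inv_bruhat_operator[OF v])
  next
    fix \<rho>
    assume \<rho>: "\<rho> \<in> extensional (carrier \<A>) \<and> \<rho> \<in> representations \<A> (group_ring W) \<and>
      (\<forall>v\<in>\<Delta>p. \<rho> (bracket_gen W S c v) = bruhat_operator W S v \<and>
        \<rho> (bracket_gen W S c (- v)) = \<ominus>\<^bsub>End_algebra (group_ring W)\<^esub> bruhat_operator W S v)"
    \<comment> \<open>Every root is positive or the negative of a positive root, so the two
      prescribed families of values cover all generators.\<close>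
    have gen: "\<rho> (bracket_gen W S c v) = bruhat_rep (bracket_gen W S c v)" if v: "v \<in> \<Delta>" for v
    proof (cases "v \<in> \<Delta>p")
      case True
      then show ?thesis
        using \<rho> by (simp add: bruhat_rep_gen[OF v] bruhat_operator_eq signed_op_def[abs_def])
    next
      case False
      then have "- v \<in> \<Delta>p" using v uminus_root nonneg_uminus_root by (simp add: pos_root_iff)
      then show ?thesis
        using \<rho> a_inv_bruhat_operator[of "- v"] by (force simp: bruhat_rep_gen[OF v])
    qed
    show "\<rho> = bruhat_rep"
    proof (rule extensionalityI[of _ "carrier \<A>"])
      show "\<rho> X = bruhat_rep X" if "X \<in> carrier \<A>" for X
        by (rule bracket_hom_eqI[of \<rho> _ bruhat_rep, OF _ _ gen that])
          (use \<rho> bruhat_rep_representation in \<open>simp_all add: representations_def\<close>)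
    qed (use \<rho> in \<open>simp_all add: bruhat_rep_def\<close>)
  qed
qed

end
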